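(* (In NF.) For all sets $A,B$, the pair $\langle A\Rightarrow B,\ ev'_{A,B}\rangle$, where $ev'_{A,B}:TA\times(A\Rightarrow B)\to TB$ is the function $ev'_{A,B}(\langle\{x\},f\rangle)=\{f(x)\}$, is a $(TA\times-)$-co-universal arrow to $TB$: for every set $C$ and every function $g:TA\times C\to TB$ there is a unique function $\overline{g}:C\to (A\Rightarrow B)$ with $ev'_{A,B}\circ(\mathrm{id}_{TA}\times\overline{g})=g$. Equivalently, there is a relative adjunction $(TA\times-)\dashv_T(A\Rightarrow-)$ with co-unit $ev'$, i.e. a bijection $$\hom(TA\times C,TB)\cong\hom(C,A\Rightarrow B)$$ natural in $C$ and $B$.
   Context: NF is the set theory axiomatised by extensionality and comprehension for stratifiable formulae. Ordered pairs are type-level Quine pairs. $\mathbf{N}$ is the category of all NF sets and all functions whose graphs are sets; $\hom$ refers to $\mathbf{N}$. $T:\mathbf{N}\to\mathbf{N}$ is the functor with $TX=\{\{x\}:x\in X\}$ and $Tf(\{a\})=\{f(a)\}$. $A\Rightarrow B$ denotes the set of all functions from $A$ to $B$ (graphs that are sets), and $A\Rightarrow-$ acts on morphisms by postcomposition. For functors $J,F,G$, the relative adjunction $G\dashv_J F$ means a natural bijection between morphisms $GX\to JY$ and morphisms $X\to FY$. *)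

theory Defs
  imports Main
begin

section \<open>The theory NF\<close>

datatype fm =
    Eq nat nat
  | Mem nat nat
  | Neg fm
  | Conj fm fm
  | All nat fm

primrec sat :: "('a \<Rightarrow> 'a \<Rightarrow> bool) \<Rightarrow> (nat \<Rightarrow> 'a) \<Rightarrow> fm \<Rightarrow> bool" where
  "sat E \<rho> (Eq i j) \<longleftrightarrow> \<rho> i = \<rho> j"
| "sat E \<rho> (Mem i j) \<longleftrightarrow> E (\<rho> i) (\<rho> j)"
| "sat E \<rho> (Neg \<phi>) \<longleftrightarrow> \<not> sat E \<rho> \<phi>"
| "sat E \<rho> (Conj \<phi> \<psi>) \<longleftrightarrow> sat E \<rho> \<phi> \<and> sat E \<rho> \<psi>"
| "sat E \<rho> (All i \<phi>) \<longleftrightarrow> (\<forall>a. sat E (\<rho>(i := a)) \<phi>)"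

text \<open>A stratification assigns one type to each variable of the formula, free or bound.\<close>

primrec stratified_by :: "(nat \<Rightarrow> nat) \<Rightarrow> fm \<Rightarrow> bool" where
  "stratified_by \<sigma> (Eq i j) \<longleftrightarrow> \<sigma> i = \<sigma> j"
| "stratified_by \<sigma> (Mem i j) \<longleftrightarrow> \<sigma> j = \<sigma> i + 1"
| "stratified_by \<sigma> (Neg \<phi>) \<longleftrightarrow> stratified_by \<sigma> \<phi>"
| "stratified_by \<sigma> (Conj \<phi> \<psi>) \<longleftrightarrow> stratified_by \<sigma> \<phi> \<and> stratified_by \<sigma> \<psi>"
| "stratified_by \<sigma> (All i \<phi>) \<longleftrightarrow> stratified_by \<sigma> \<phi>"

definition stratifiable :: "fm \<Rightarrow> bool" where
  "stratifiable \<phi> \<longleftrightarrow> (\<exists>\<sigma>. stratified_by \<sigma> \<phi>)"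

text \<open>A type of class \<open>nf\<close> is a model of NF. The assignment \<open>\<rho>\<close> supplies the parameters
  of a comprehension instance, and the variable \<open>v\<close> ranges over the members of the new set \<open>y\<close>.
  Since \<open>y\<close> is bound outside the object language, it cannot occur in \<open>\<phi>\<close>.\<close>

class nf =
  fixes mem :: "'a \<Rightarrow> 'a \<Rightarrow> bool"  (infix "\<^bold>\<in>" 50)
  assumes extensionality: "(\<forall>z. z \<^bold>\<in> x \<longleftrightarrow> z \<^bold>\<in> y) \<Longrightarrow> x = y"
    and comprehension: "stratifiable \<phi> \<Longrightarrow> \<exists>y. \<forall>x. x \<^bold>\<in> y \<longleftrightarrow> sat mem (\<rho>(v := x)) \<phi>"

text \<open>\<open>nfset P\<close> is the set \<open>{x. P x}\<close> of the model. It is meaningful only where such a set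
  exists, as it does for every stratified \<open>P\<close>.\<close>

definition nfset :: "('a::nf \<Rightarrow> bool) \<Rightarrow> 'a" where
  "nfset P = (THE y. \<forall>x. x \<^bold>\<in> y \<longleftrightarrow> P x)"

lemma mem_nfset:
  assumes "\<exists>y. \<forall>x. x \<^bold>\<in> y \<longleftrightarrow> P x"
  shows "x \<^bold>\<in> nfset P \<longleftrightarrow> P x"
proof -
  from assms obtain y where y: "\<forall>x. x \<^bold>\<in> y \<longleftrightarrow> P x" by blast
  then have "nfset P = y"
    unfolding nfset_def by (intro the_equality) (auto intro: extensionality)
  with y show ?thesis by simp
qed

definition sing :: "'a::nf \<Rightarrow> 'a" where
  "sing a = nfset (\<lambda>x. x = a)"

definition union :: "'a::nf \<Rightarrow> 'a \<Rightarrow> 'a" where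
  "union a b = nfset (\<lambda>x. x \<^bold>\<in> a \<or> x \<^bold>\<in> b)"


section \<open>Quine pairs\<close>

text \<open>Natural numbers are Frege numerals: \<open>n\<close> is the set of all sets with \<open>n\<close> elements.\<close>

definition zero :: "'a::nf" where
  "zero = sing (nfset (\<lambda>x. False))"

definition succ :: "'a::nf \<Rightarrow> 'a" where
  "succ n = nfset (\<lambda>z. \<exists>x y. x \<^bold>\<in> n \<and> \<not> y \<^bold>\<in> x \<and> z = union x (sing y))"

definition Nn :: "'a::nf" where
  "Nn = nfset (\<lambda>n. \<forall>I. zero \<^bold>\<in> I \<and> (\<forall>m. m \<^bold>\<in> I \<longrightarrow> succ m \<^bold>\<in> I) \<longrightarrow> n \<^bold>\<in> I)"

definition shift :: "'a::nf \<Rightarrow> 'a" where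
  "shift x = nfset (\<lambda>z. \<exists>y. y \<^bold>\<in> x \<and> z = (if y \<^bold>\<in> Nn then succ y else y))"

text \<open>The members of \<open>a\<close> are coded by sets without \<open>0\<close>, those of \<open>b\<close> by sets with \<open>0\<close>, so the
  pair has the same type as its components.\<close>

definition pair :: "'a::nf \<Rightarrow> 'a \<Rightarrow> 'a"  ("\<langle>_,/ _\<rangle>") where
  "\<langle>a, b\<rangle> = nfset (\<lambda>z. (\<exists>x. x \<^bold>\<in> a \<and> z = shift x) \<or>
                      (\<exists>x. x \<^bold>\<in> b \<and> z = union (shift x) (sing zero)))"


section \<open>The category of NF sets and functions\<close>

definition times :: "'a::nf \<Rightarrow> 'a \<Rightarrow> 'a"  (infixr "\<^bold>\<times>" 80) where
  "A \<^bold>\<times> B = nfset (\<lambda>p. \<exists>a b. a \<^bold>\<in> A \<and> b \<^bold>\<in> B \<and> p = \<langle>a, b\<rangle>)"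

definition is_function :: "'a::nf \<Rightarrow> 'a \<Rightarrow> 'a \<Rightarrow> bool" where
  "is_function A B f \<longleftrightarrow>
     (\<forall>p. p \<^bold>\<in> f \<longrightarrow> (\<exists>a b. a \<^bold>\<in> A \<and> b \<^bold>\<in> B \<and> p = \<langle>a, b\<rangle>)) \<and>
     (\<forall>a. a \<^bold>\<in> A \<longrightarrow> (\<exists>!b. \<langle>a, b\<rangle> \<^bold>\<in> f))"

definition funs :: "'a::nf \<Rightarrow> 'a \<Rightarrow> 'a"  (infixr "\<^bold>\<Rightarrow>" 75) where
  "A \<^bold>\<Rightarrow> B = nfset (\<lambda>f. is_function A B f)"

text \<open>A morphism from \<open>A\<close> to \<open>B\<close> is represented by its graph. Its codomain is not part of the
  graph and is supplied by the hom-set, which is itself a set of the model.\<close>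

abbreviation (input) hom :: "'a::nf \<Rightarrow> 'a \<Rightarrow> 'a" where
  "hom A B \<equiv> A \<^bold>\<Rightarrow> B"

definition app :: "'a::nf \<Rightarrow> 'a \<Rightarrow> 'a"  (infixl "\<^bold>\<cdot>" 85) where
  "f \<^bold>\<cdot> x = (THE y. \<langle>x, y\<rangle> \<^bold>\<in> f)"

definition ident :: "'a::nf \<Rightarrow> 'a" where
  "ident A = nfset (\<lambda>p. \<exists>x. x \<^bold>\<in> A \<and> p = \<langle>x, x\<rangle>)"

definition compose :: "'a::nf \<Rightarrow> 'a \<Rightarrow> 'a"  (infixl "\<^bold>\<circ>" 82) where
  "g \<^bold>\<circ> f = nfset (\<lambda>p. \<exists>x y z. \<langle>x, y\<rangle> \<^bold>\<in> f \<and> \<langle>y, z\<rangle> \<^bold>\<in> g \<and> p = \<langle>x, z\<rangle>)"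

definition times_map :: "'a::nf \<Rightarrow> 'a \<Rightarrow> 'a" where
  "times_map f g =
     nfset (\<lambda>p. \<exists>a b c d. \<langle>a, b\<rangle> \<^bold>\<in> f \<and> \<langle>c, d\<rangle> \<^bold>\<in> g \<and> p = \<langle>\<langle>a, c\<rangle>, \<langle>b, d\<rangle>\<rangle>)"

definition bijection :: "'a::nf \<Rightarrow> 'a \<Rightarrow> 'a \<Rightarrow> bool" where
  "bijection X Y f \<longleftrightarrow> f \<^bold>\<in> hom X Y \<and> (\<forall>y. y \<^bold>\<in> Y \<longrightarrow> (\<exists>!x. x \<^bold>\<in> X \<and> f \<^bold>\<cdot> x = y))"


section \<open>Functors, co-universal arrows and relative adjunctions\<close>

text \<open>\<open>Arr F X Y f\<close> is the action of \<open>F\<close> on the morphism \<open>f\<close> from \<open>X\<close> to \<open>Y\<close>.\<close>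

record 'a endo =
  Obj :: "'a \<Rightarrow> 'a"
  Arr :: "'a \<Rightarrow> 'a \<Rightarrow> 'a \<Rightarrow> 'a"

definition is_functor :: "'a::nf endo \<Rightarrow> bool" where
  "is_functor F \<longleftrightarrow>
     (\<forall>X Y f. f \<^bold>\<in> hom X Y \<longrightarrow> Arr F X Y f \<^bold>\<in> hom (Obj F X) (Obj F Y)) \<and>
     (\<forall>X. Arr F X X (ident X) = ident (Obj F X)) \<and>
     (\<forall>X Y Z f g. f \<^bold>\<in> hom X Y \<and> g \<^bold>\<in> hom Y Z \<longrightarrow>
        Arr F X Z (g \<^bold>\<circ> f) = Arr F Y Z g \<^bold>\<circ> Arr F X Y f)"

text \<open>\<open>\<langle>R, e\<rangle>\<close> is a \<open>G\<close>-co-universal arrow to \<open>Y\<close>.\<close>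

definition couniversal_arrow :: "'a::nf endo \<Rightarrow> 'a \<Rightarrow> 'a \<Rightarrow> 'a \<Rightarrow> bool" where
  "couniversal_arrow G R e Y \<longleftrightarrow>
     is_functor G \<and> e \<^bold>\<in> hom (Obj G R) Y \<and>
     (\<forall>C g. g \<^bold>\<in> hom (Obj G C) Y \<longrightarrow>
        (\<exists>!u. u \<^bold>\<in> hom C R \<and> e \<^bold>\<circ> Arr G C R u = g))"

text \<open>\<open>\<Phi>\<close> witnesses that \<open>G\<close> is left adjoint to \<open>F\<close> relative to \<open>J\<close>. Each component
  \<open>\<Phi> X Y\<close> is a function of the model from the set of morphisms \<open>G X \<rightarrow> J Y\<close> to the set of
  morphisms \<open>X \<rightarrow> F Y\<close>.\<close>

definition rel_adjunction ::
  "'a::nf endo \<Rightarrow> 'a endo \<Rightarrow> 'a endo \<Rightarrow> ('a \<Rightarrow> 'a \<Rightarrow> 'a) \<Rightarrow> bool" where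
  "rel_adjunction G J F \<Phi> \<longleftrightarrow>
     is_functor G \<and> is_functor J \<and> is_functor F \<and>
     (\<forall>X Y. bijection (hom (Obj G X) (Obj J Y)) (hom X (Obj F Y)) (\<Phi> X Y)) \<and>
     (\<forall>X X' Y k g. k \<^bold>\<in> hom X' X \<and> g \<^bold>\<in> hom (Obj G X) (Obj J Y) \<longrightarrow>
        \<Phi> X' Y \<^bold>\<cdot> (g \<^bold>\<circ> Arr G X' X k) = (\<Phi> X Y \<^bold>\<cdot> g) \<^bold>\<circ> k) \<and>
     (\<forall>X Y Y' h g. h \<^bold>\<in> hom Y Y' \<and> g \<^bold>\<in> hom (Obj G X) (Obj J Y) \<longrightarrow>
        \<Phi> X Y' \<^bold>\<cdot> (Arr J Y Y' h \<^bold>\<circ> g) = Arr F Y Y' h \<^bold>\<circ> (\<Phi> X Y \<^bold>\<cdot> g))"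

text \<open>The co-unit at \<open>Y\<close> is the morphism \<open>G (F Y) \<rightarrow> J Y\<close> that corresponds to the identity
  of \<open>F Y\<close>.\<close>

definition has_counit ::
  "'a::nf endo \<Rightarrow> 'a endo \<Rightarrow> 'a endo \<Rightarrow> ('a \<Rightarrow> 'a \<Rightarrow> 'a) \<Rightarrow> ('a \<Rightarrow> 'a) \<Rightarrow> bool" where
  "has_counit G J F \<Phi> \<epsilon> \<longleftrightarrow>
     (\<forall>Y. \<epsilon> Y \<^bold>\<in> hom (Obj G (Obj F Y)) (Obj J Y) \<and>
          \<Phi> (Obj F Y) Y \<^bold>\<cdot> \<epsilon> Y = ident (Obj F Y))"


section \<open>Exponentials and evaluation\<close>

definition T :: "'a::nf \<Rightarrow> 'a" where
  "T X = nfset (\<lambda>z. \<exists>x. x \<^bold>\<in> X \<and> z = sing x)"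

definition T_map :: "'a::nf \<Rightarrow> 'a" where
  "T_map f = nfset (\<lambda>p. \<exists>x y. \<langle>x, y\<rangle> \<^bold>\<in> f \<and> p = \<langle>sing x, sing y\<rangle>)"

definition T_functor :: "'a::nf endo" where
  "T_functor = \<lparr>Obj = T, Arr = (\<lambda>X Y f. T_map f)\<rparr>"

definition prod_functor :: "'a::nf \<Rightarrow> 'a endo" where
  "prod_functor A = \<lparr>Obj = (\<lambda>X. A \<^bold>\<times> X), Arr = (\<lambda>X Y f. times_map (ident A) f)\<rparr>"

definition exp_functor :: "'a::nf \<Rightarrow> 'a endo" where
  "exp_functor A =
     \<lparr>Obj = (\<lambda>X. A \<^bold>\<Rightarrow> X),
      Arr = (\<lambda>X Y h. nfset (\<lambda>p. \<exists>f. f \<^bold>\<in> (A \<^bold>\<Rightarrow> X) \<and> p = \<langle>f, h \<^bold>\<circ> f\<rangle>))\<rparr>"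

definition ev' :: "'a::nf \<Rightarrow> 'a \<Rightarrow> 'a" where
  "ev' A B = nfset (\<lambda>p. \<exists>x f. x \<^bold>\<in> A \<and> f \<^bold>\<in> (A \<^bold>\<Rightarrow> B) \<and> p = \<langle>\<langle>sing x, f\<rangle>, sing (f \<^bold>\<cdot> x)\<rangle>)"

end

theory Submission
  imports Defs "HOL-Library.Nat_Bijection"
begin

text \<open>
Currying fails in NF for a reason of types. A function \<open>f\<close> from \<open>A\<close> to \<open>B\<close> lies one
type above its arguments and values, so the relation between \<open>\<langle>x, f\<rangle>\<close> and the
value of \<open>f\<close> at \<open>x\<close> is not stratified. Passing to \<open>{x}\<close> and to the singleton of the
value repairs this: the function \<open>ev'\<close> is a set, and so is, for \<open>g\<close> from
\<open>T A \<^bold>\<times> C\<close> to \<open>T B\<close>, the transpose that sends \<open>x\<close> in \<open>C\<close> to the set of all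
pairs \<open>\<langle>a, y\<rangle>\<close> with \<open>\<langle>\<langle>{a}, x\<rangle>, {y}\<rangle>\<close> in \<open>g\<close>
(\<open>curried\<close>). Functions are determined by their values and \<open>{y}\<close> determines \<open>y\<close>, so
transposition is inverse to composing with \<open>ev'\<close>, and uniqueness and naturality are pointwise
computations.

For this, pairs must be injective, and for Quine pairs that is a substantial fact. It requires the successor
to be injective on the Frege numerals, hence that no numeral contains the universe. This is the axiom
of infinity, a theorem of NF due to Specker (\<open>infinity\<close>). If the universe were finite with
\<open>n\<close> elements, then \<open>n = 2 ^ m\<close> where \<open>m\<close> is the number of singletons, as the universe is its
own power set. So \<open>m\<close> is the binary logarithm of \<open>n\<close>, and the number of times that the
logarithm can be iterated has opposite parities for \<open>m\<close> and \<open>n\<close>. But passing to singletons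
preserves all arithmetic, in particular this parity (\<open>odd_height_T\<close>).

All sets come from comprehension for formulas of a deep embedding. The first part derives from it a
set of syntax-directed rules under which predicates and terms of the logic are recognised as stratified, so
that formulas and variable names do not appear afterwards.
\<close>

section \<open>A calculus for stratified comprehension\<close>

primrec rename :: "(nat \<Rightarrow> nat) \<Rightarrow> fm \<Rightarrow> fm" where
  "rename \<pi> (Eq i j) = Eq (\<pi> i) (\<pi> j)"
| "rename \<pi> (Mem i j) = Mem (\<pi> i) (\<pi> j)"
| "rename \<pi> (Neg \<phi>) = Neg (rename \<pi> \<phi>)"
| "rename \<pi> (Conj \<phi> \<psi>) = Conj (rename \<pi> \<phi>) (rename \<pi> \<psi>)"
| "rename \<pi> (All i \<phi>) = All (\<pi> i) (rename \<pi> \<phi>)"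

lemma sat_rename:
  assumes "inj \<pi>"
  shows "sat E \<rho> (rename \<pi> \<phi>) \<longleftrightarrow> sat E (\<rho> \<circ> \<pi>) \<phi>"
proof (induction \<phi> arbitrary: \<rho>)
  case (All i \<phi>)
  have "(\<lambda>n. (\<rho>(\<pi> i := a)) (\<pi> n)) = (\<lambda>n. \<rho> (\<pi> n))(i := a)" for a
    using assms by (auto simp: fun_eq_iff inj_eq)
  with All show ?case by (simp del: fun_upd_apply add: comp_def)
qed simp_all

lemma stratified_by_rename:
  "stratified_by \<sigma> (rename \<pi> \<phi>) \<longleftrightarrow> stratified_by (\<sigma> \<circ> \<pi>) \<phi>"
  by (induction \<phi>) simp_all

text \<open>The even variables of a formula carry the environment and the odd ones everything else, that is,
parameters and bound variables. Keeping both supplies infinite means that a fresh variable of any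
type is always at hand.\<close>

definition vars :: "(nat \<Rightarrow> 'b) \<Rightarrow> (nat \<Rightarrow> 'b) \<Rightarrow> nat \<Rightarrow> 'b" where
  "vars e p n = (case sum_decode n of Inl i \<Rightarrow> e i | Inr k \<Rightarrow> p k)"

text \<open>A predicate on environments is \<open>stratified\<close> for the type assignment \<open>\<Gamma>\<close> of its
arguments when some stratified formula with parameters expresses it. The parameters \<open>p\<close>
are chosen together with the types of their variables, so one and the same element of the model may
occur in a predicate at several types. This is what lets closed terms, and sets that are fixed
throughout an argument, be used without regard to their type.\<close>

definition stratified :: "(nat \<Rightarrow> nat) \<Rightarrow> ((nat \<Rightarrow> 'a::nf) \<Rightarrow> bool) \<Rightarrow> bool" where
  "stratified \<Gamma> P \<longleftrightarrow> (\<exists>\<phi> \<delta> p. stratified_by (vars \<Gamma> \<delta>) \<phi> \<and> (\<forall>e. sat mem (vars e p) \<phi> \<longleftrightarrow> P e))"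

definition scons :: "'b \<Rightarrow> (nat \<Rightarrow> 'b) \<Rightarrow> nat \<Rightarrow> 'b"  (infixr "##" 65) where
  "(x ## s) n = (case n of 0 \<Rightarrow> x | Suc m \<Rightarrow> s m)"

lemma scons_simps [simp]: "(x ## s) 0 = x" "(x ## s) (Suc n) = s n"
  by (simp_all add: scons_def)

lemma inj_scons:
  assumes "inj s" "\<And>i. s i \<noteq> x"
  shows "inj (x ## s)"
proof (rule injI)
  show "m = n" if "(x ## s) m = (x ## s) n" for m n
    using that assms(2) assms(2)[symmetric] by (cases m; cases n) (simp_all add: inj_eq[OF assms(1)])
qed

lemma scons_eqI: "f 0 = x \<Longrightarrow> (\<And>i. f (Suc i) = s i) \<Longrightarrow> f n = (x ## s) n"
  by (cases n) simp_all

lemma scons_neq: "x \<noteq> z \<Longrightarrow> (\<And>i. s i \<noteq> z) \<Longrightarrow> (x ## s) n \<noteq> z"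
  by (cases n) simp_all

lemma inj_case_sum:
  assumes "inj f" "inj g" "\<And>i k. f i \<noteq> g k"
  shows "inj (case_sum f g)"
proof (rule injI)
  show "m = n" if "case_sum f g m = case_sum f g n" for m n
    using that assms(3) assms(3)[symmetric]
    by (cases m; cases n) (simp_all add: inj_eq[OF assms(1)] inj_eq[OF assms(2)])
qed

text \<open>Two formulas are joined after their odd variables have been moved apart, to the even and to the odd
positions among the odd variables.\<close>

definition interleave :: "(nat \<Rightarrow> 'b) \<Rightarrow> (nat \<Rightarrow> 'b) \<Rightarrow> nat \<Rightarrow> 'b" where
  "interleave u v k = (if even k then u (k div 2) else v (k div 2))"

lemma interleave_simps [simp]: "interleave u v (2 * k) = u k" "interleave u v (Suc (2 * k)) = v k"
  by (simp_all add: interleave_def)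

text \<open>A function of the environment is a stratified term of type \<open>t\<close> when its graph is stratified;
the value of the term takes the new argument position 0.\<close>

definition sterm :: "(nat \<Rightarrow> nat) \<Rightarrow> nat \<Rightarrow> ((nat \<Rightarrow> 'a::nf) \<Rightarrow> 'a) \<Rightarrow> bool" where
  "sterm \<Gamma> t f \<longleftrightarrow> stratified (t ## \<Gamma>) (\<lambda>e. e 0 = f (\<lambda>i. e (Suc i)))"

lemma vars_simps [simp]:
  "vars e p (sum_encode (Inl i)) = e i" "vars e p (sum_encode (Inr k)) = p k"
  by (simp_all add: vars_def)

text \<open>Renamings of variables, given by their effect on argument positions and on the other variables.\<close>

definition resum :: "(nat + nat \<Rightarrow> nat + nat) \<Rightarrow> nat \<Rightarrow> nat" where
  "resum m n = sum_encode (m (sum_decode n))"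

lemma inj_resum: "inj m \<Longrightarrow> inj (resum m)"
  unfolding resum_def inj_def by (metis sum_encode_inverse sum_decode_inverse)

lemma vars_resum:
  assumes "\<And>i. e i = vars e' p' (sum_encode (m (Inl i)))"
    and "\<And>k. p k = vars e' p' (sum_encode (m (Inr k)))"
  shows "vars e' p' \<circ> resum m = vars e p"
proof
  fix n
  show "(vars e' p' \<circ> resum m) n = vars e p n"
    using assms by (cases "sum_decode n") (simp_all add: vars_def[of e p n] resum_def)
qed

lemma stratified_not: "stratified \<Gamma> P \<Longrightarrow> stratified \<Gamma> (\<lambda>e. \<not> P e)"
  unfolding stratified_def by (metis sat.simps(3) stratified_by.simps(3))

lemma stratified_conj:
  assumes "stratified \<Gamma> P" "stratified \<Gamma> Q"
  shows "stratified \<Gamma> (\<lambda>e. P e \<and> Q e)"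
proof -
  obtain \<phi> \<delta> p where 1: "stratified_by (vars \<Gamma> \<delta>) \<phi>" "\<And>e. sat mem (vars e p) \<phi> \<longleftrightarrow> P e"
    using assms(1) unfolding stratified_def by blast
  obtain \<psi> \<epsilon> q where 2: "stratified_by (vars \<Gamma> \<epsilon>) \<psi>" "\<And>e. sat mem (vars e q) \<psi> \<longleftrightarrow> Q e"
    using assms(2) unfolding stratified_def by blast
  define l r where "l = map_sum (id::nat\<Rightarrow>nat) (\<lambda>k::nat. 2 * k)"
    and "r = map_sum (id::nat\<Rightarrow>nat) (\<lambda>k::nat. Suc (2 * k))"
  have inj: "inj (resum l)" "inj (resum r)"
    unfolding l_def r_def by (intro inj_resum sum.inj_map; simp add: inj_def)+
  have L: "vars e (interleave u v) \<circ> resum l = vars e u"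
    and R: "vars e (interleave u v) \<circ> resum r = vars e v" for e u v :: "nat \<Rightarrow> 'c"
    by (rule vars_resum; simp add: l_def r_def)+
  show ?thesis
    unfolding stratified_def
    by (rule exI[of _ "Conj (rename (resum l) \<phi>) (rename (resum r) \<psi>)"],
        rule exI[of _ "interleave \<delta> \<epsilon>"], rule exI[of _ "interleave p q"])
      (simp add: stratified_by_rename sat_rename inj L R 1 2)
qed

text \<open>The argument position 0 becomes a bound variable, so it has to move to the first odd variable;
the remaining positions move down to close the gap.\<close>

lemma stratified_all:
  assumes "stratified (t ## \<Gamma>) (\<lambda>e. P (e 0) (\<lambda>i. e (Suc i)))"
  shows "stratified \<Gamma> (\<lambda>e. \<forall>a. P a e)"
proof -
  obtain \<phi> \<delta> p where 1: "stratified_by (vars (t ## \<Gamma>) \<delta>) \<phi>"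
    "\<And>e. sat mem (vars e p) \<phi> \<longleftrightarrow> P (e 0) (\<lambda>i. e (Suc i))"
    using assms unfolding stratified_def by blast
  define m :: "nat + nat \<Rightarrow> nat + nat" where
    "m = case_sum (Inr 0 ## Inl) (\<lambda>k. Inr (Suc k))"
  have inj: "inj (resum m)"
    unfolding m_def
      by (intro inj_resum inj_case_sum inj_scons scons_neq) (auto simp: inj_def double_not_eq_Suc_double)
  have M: "vars e (a ## u) \<circ> resum m = vars (a ## e) u" for a and e u :: "nat \<Rightarrow> 'c"
    by (rule vars_resum) (auto simp: m_def scons_def split: nat.split)
  have U: "(vars e (b ## u))(sum_encode (Inr 0) := a) = vars e (a ## u)" for a b and e u :: "nat \<Rightarrow> 'a"
    by (rule ext) (auto simp: vars_def scons_def split: sum.split nat.split,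
      metis sum_decode_inverse)
  have "sat mem (vars e (p 0 ## p)) (All (sum_encode (Inr 0)) (rename (resum m) \<phi>)) \<longleftrightarrow> (\<forall>a. P a e)" for e
    by (simp add: sat_rename inj U M 1)
  moreover have "stratified_by (vars \<Gamma> (t ## \<delta>)) (All (sum_encode (Inr 0)) (rename (resum m) \<phi>))"
    by (simp add: stratified_by_rename M 1)
  ultimately show ?thesis
    unfolding stratified_def by blast
qed

lemma stratified_rename:
  assumes "stratified \<Gamma> P" "inj \<pi>" "\<And>i. \<Gamma>' (\<pi> i) = \<Gamma> i"
  shows "stratified \<Gamma>' (\<lambda>e. P (\<lambda>i. e (\<pi> i)))"
proof -
  obtain \<phi> \<delta> p where 1: "stratified_by (vars \<Gamma> \<delta>) \<phi>" "\<And>e. sat mem (vars e p) \<phi> \<longleftrightarrow> P e"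
    using assms(1) unfolding stratified_def by blast
  define m where "m = map_sum \<pi> (id::nat\<Rightarrow>nat)"
  have inj: "inj (resum m)"
    unfolding m_def by (intro inj_resum sum.inj_map assms) simp_all
  have M: "vars e u \<circ> resum m = vars (\<lambda>i. e (\<pi> i)) u" for e u :: "nat \<Rightarrow> 'c"
    by (rule vars_resum) (simp_all add: m_def)
  show ?thesis
    unfolding stratified_def
    by (rule exI[of _ "rename (resum m) \<phi>"], rule exI[of _ \<delta>], rule exI[of _ p])
      (simp add: stratified_by_rename sat_rename inj M 1 assms(3))
qed

lemma stratified_weaken_second:
  assumes "stratified (t ## \<Gamma>) (\<lambda>e. P (e 0) (\<lambda>i. e (Suc i)))"
  shows "stratified (t ## s ## \<Gamma>) (\<lambda>e. P (e 0) (\<lambda>i. e (Suc (Suc i))))"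
proof -
  have i: "inj (0 ## (\<lambda>i. Suc (Suc i)))"
    by (intro inj_scons scons_neq) (auto simp: inj_def)
  have c: "(t ## s ## \<Gamma>) ((0 ## (\<lambda>i. Suc (Suc i))) i) = (t ## \<Gamma>) i" for i
    by (intro scons_eqI) simp_all
  show ?thesis
    using stratified_rename[OF assms i, of "t ## s ## \<Gamma>", OF c] by simp
qed

lemma stratified_swap:
  assumes "stratified (t ## s ## \<Gamma>) (\<lambda>e. P (e 0) (e (Suc 0)))"
  shows "stratified (s ## t ## \<Gamma>) (\<lambda>e. P (e (Suc 0)) (e 0))"
proof -
  have i: "inj (Suc 0 ## 0 ## (\<lambda>i. Suc (Suc i)))"
    by (intro inj_scons scons_neq) (auto simp: inj_def)
  have c: "(s ## t ## \<Gamma>) ((Suc 0 ## 0 ## (\<lambda>i. Suc (Suc i))) i) = (t ## s ## \<Gamma>) i" for i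
    by (intro scons_eqI) simp_all
  show ?thesis
    using stratified_rename[OF assms i, of "s ## t ## \<Gamma>", OF c] by simp
qed

lemma stratified_const: "stratified \<Gamma> (\<lambda>e. Q)"
proof -
  have T: "stratified \<Gamma> (\<lambda>e. True)"
    unfolding stratified_def by (rule exI[of _ "Eq 0 0"], rule exI[of _ \<Gamma>]) simp
  show ?thesis
    using T stratified_not[OF T] by (cases Q) simp_all
qed

lemma stratified_disj:
  assumes "stratified \<Gamma> P" "stratified \<Gamma> Q"
  shows "stratified \<Gamma> (\<lambda>e. P e \<or> Q e)"
  using stratified_not[OF stratified_conj[OF stratified_not[OF assms(1)] stratified_not[OF assms(2)]]] by simp

lemma stratified_imp:
  assumes "stratified \<Gamma> P" "stratified \<Gamma> Q"
  shows "stratified \<Gamma> (\<lambda>e. P e \<longrightarrow> Q e)"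
  using stratified_disj[OF stratified_not[OF assms(1)] assms(2)] by simp

lemma stratified_iff:
  assumes "stratified \<Gamma> P" "stratified \<Gamma> Q"
  shows "stratified \<Gamma> (\<lambda>e. P e \<longleftrightarrow> Q e)"
proof -
  have "stratified \<Gamma> (\<lambda>e. (P e \<longrightarrow> Q e) \<and> (Q e \<longrightarrow> P e))"
    by (intro stratified_conj stratified_imp assms)
  then show ?thesis by (simp add: iff_conv_conj_imp)
qed

lemma stratified_ex:
  assumes "stratified (t ## \<Gamma>) (\<lambda>e. P (e 0) (\<lambda>i. e (Suc i)))"
  shows "stratified \<Gamma> (\<lambda>e. \<exists>a. P a e)"
  using stratified_not[OF stratified_all[of t \<Gamma> "\<lambda>a e. \<not> P a e"]] stratified_not[OF assms] by simp

lemma stratified_cong: "stratified \<Gamma> P \<Longrightarrow> (\<And>e. P e \<longleftrightarrow> Q e) \<Longrightarrow> stratified \<Gamma> Q"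
  by (rule arg_cong[of P Q "stratified \<Gamma>", THEN iffD1]) (simp_all add: fun_eq_iff)

lemma stratified_eq_atom:
  assumes "\<Gamma> i = \<Gamma> j"
  shows "stratified \<Gamma> (\<lambda>e. e i = e j)"
  unfolding stratified_def
  by (rule exI[of _ "Eq (sum_encode (Inl i)) (sum_encode (Inl j))"]) (simp add: assms)

lemma stratified_mem_atom:
  assumes "\<Gamma> j = Suc (\<Gamma> i)"
  shows "stratified \<Gamma> (\<lambda>e. e i \<^bold>\<in> e j)"
  unfolding stratified_def
  by (rule exI[of _ "Mem (sum_encode (Inl i)) (sum_encode (Inl j))"]) (simp add: assms)

lemma stratified_subst:
  assumes "stratified (t ## \<Gamma>) (\<lambda>e. P (e 0) (\<lambda>i. e (Suc i)))" "sterm \<Gamma> t f"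
  shows "stratified \<Gamma> (\<lambda>e. P (f e) e)"
  using stratified_ex[OF stratified_conj[OF assms(2)[unfolded sterm_def] assms(1)]] by simp

lemma sterm_weaken: "sterm \<Gamma> t f \<Longrightarrow> sterm (s ## \<Gamma>) t (\<lambda>e. f (\<lambda>i. e (Suc i)))"
  unfolding sterm_def by (rule stratified_weaken_second[where P = "\<lambda>a e. a = f e"])

lemma sterm_const: "sterm \<Gamma> t (\<lambda>e. c)"
  unfolding stratified_def sterm_def
  by (rule exI[of _ "Eq (sum_encode (Inl 0)) (sum_encode (Inr 0))"], rule exI[of _ "\<lambda>_. t"],
      rule exI[of _ "\<lambda>_. c"]) (simp)

lemma sterm_var: "\<Gamma> i = t \<Longrightarrow> sterm \<Gamma> t (\<lambda>e. e i)"
  unfolding sterm_def by (rule stratified_eq_atom) simp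

lemma sterm_var0: "sterm (t ## \<Gamma>) t (\<lambda>e. e 0)"
  and sterm_var1: "sterm (t0 ## t ## \<Gamma>) t (\<lambda>e. e (Suc 0))"
  and sterm_var2: "sterm (t0 ## t1 ## t ## \<Gamma>) t (\<lambda>e. e (Suc (Suc 0)))"
  and sterm_var3: "sterm (t0 ## t1 ## t2 ## t ## \<Gamma>) t (\<lambda>e. e (Suc (Suc (Suc 0))))"
  and sterm_var4: "sterm (t0 ## t1 ## t2 ## t3 ## t ## \<Gamma>) t (\<lambda>e. e (Suc (Suc (Suc (Suc 0)))))"
  and sterm_var5: "sterm (t0 ## t1 ## t2 ## t3 ## t4 ## t ## \<Gamma>) t (\<lambda>e. e (Suc (Suc (Suc (Suc (Suc 0))))))"
  and sterm_var6: "sterm (t0 ## t1 ## t2 ## t3 ## t4 ## t5 ## t ## \<Gamma>) t (\<lambda>e. e (Suc (Suc (Suc (Suc (Suc (Suc 0)))))))"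
  by (rule sterm_var; simp)+

lemmas sterm_vars =
  sterm_var0 sterm_var1 sterm_var2 sterm_var3 sterm_var4 sterm_var5 sterm_var6

lemma stratified_subst2:
  assumes "stratified (t ## s ## \<Gamma>) (\<lambda>e. P (e 0) (e (Suc 0)) (\<lambda>i. e (Suc (Suc i))))" "sterm \<Gamma> t f" "sterm \<Gamma> s g"
  shows "stratified \<Gamma> (\<lambda>e. P (f e) (g e) e)"
  by (rule stratified_subst[OF _ assms(3)],
      rule stratified_subst[where P = "\<lambda>x e. P x (e 0) (\<lambda>i. e (Suc i))",
        OF assms(1) sterm_weaken[OF assms(2)]])

lemma stratified_eq: "sterm \<Gamma> t f \<Longrightarrow> sterm \<Gamma> t g \<Longrightarrow> stratified \<Gamma> (\<lambda>e. f e = g e)"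
  by (rule stratified_subst2[where P = "\<lambda>a b e. a = b"], rule stratified_eq_atom) simp_all

lemma stratified_mem: "sterm \<Gamma> t f \<Longrightarrow> sterm \<Gamma> (Suc t) g \<Longrightarrow> stratified \<Gamma> (\<lambda>e. f e \<^bold>\<in> g e)"
  by (rule stratified_subst2[where P = "\<lambda>a b e. a \<^bold>\<in> b"], rule stratified_mem_atom) simp_all

text \<open>The premise leaves an unrelated argument of the same type in position 1, which is where the
candidate for the unique element sits when uniqueness is spelt out with one more quantifier.\<close>

lemma stratified_ex1:
  assumes "stratified (t ## t ## \<Gamma>) (\<lambda>e. P (e 0) (\<lambda>i. e (Suc (Suc i))))"
  shows "stratified \<Gamma> (\<lambda>e. \<exists>!a. P a e)"
proof -
  have "stratified \<Gamma> (\<lambda>e. \<exists>a. \<forall>b. P b e \<longleftrightarrow> b = a)"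
    by (rule stratified_ex[of t], rule stratified_all[of t], rule stratified_iff[OF assms stratified_eq]; rule sterm_vars)
  then show ?thesis
    by (rule stratified_cong) metis
qed

text \<open>Comprehension in the form in which it is applied below. The premise is an instance of the rules
\<open>strat\<close> collected further down, so that existence of a set is established by following the
syntax of its defining condition while unification works out the types.\<close>

theorem nfset_iff:
  assumes "stratified (t ## \<Gamma>) (\<lambda>e. P (e 0))"
  shows "x \<^bold>\<in> nfset P \<longleftrightarrow> P x"
proof (rule mem_nfset)
  obtain \<phi> \<delta> p where 1: "stratified_by (vars (t ## \<Gamma>) \<delta>) \<phi>" "\<And>e. sat mem (vars e p) \<phi> \<longleftrightarrow> P (e 0)"
    using assms unfolding stratified_def by blast
  obtain y where y: "\<And>x. x \<^bold>\<in> y \<longleftrightarrow> sat mem ((vars undefined p)(sum_encode (Inl 0) := x)) \<phi>"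
    using comprehension[of \<phi> "vars undefined p" "sum_encode (Inl 0)"] 1(1)
    unfolding stratifiable_def by blast
  have U: "(vars e p)(sum_encode (Inl 0) := x) = vars (e(0 := x)) p" for x e
    by (rule ext) (auto simp: vars_def split: sum.split,
      metis sum_decode_inverse)
  show "\<exists>y. \<forall>x. x \<^bold>\<in> y \<longleftrightarrow> P x"
    using y by (auto simp: 1 U)
qed

text \<open>An abstraction is definable by a stratified formula because \<open>y = {x. P x}\<close> says that
\<open>y\<close> has exactly the members \<open>x\<close> with \<open>P x\<close>. This needs the set to exist for every
value of the arguments of \<open>P\<close>, and for that these arguments are turned into parameters.\<close>

lemma sterm_nfset:
  assumes "stratified (t ## \<Gamma>) (\<lambda>e. P (e 0) (\<lambda>i. e (Suc i)))"
  shows "sterm \<Gamma> (Suc t) (\<lambda>e. nfset (\<lambda>x. P x e))"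
proof -
  obtain \<phi> \<delta> p where 1: "stratified_by (vars (t ## \<Gamma>) \<delta>) \<phi>"
    "\<And>e. sat mem (vars e p) \<phi> \<longleftrightarrow> P (e 0) (\<lambda>i. e (Suc i))"
    using assms unfolding stratified_def by blast
  \<comment> \<open>The arguments other than the member variable become parameters with the fixed values \<open>e\<close>.\<close>
  have ex: "stratified (t ## \<Gamma>) (\<lambda>e'. P (e' 0) e)" for e
  proof -
    define m :: "nat + nat \<Rightarrow> nat + nat" where
      "m = case_sum (Inl 0 ## (\<lambda>i. Inr (2 * i))) (\<lambda>k. Inr (Suc (2 * k)))"
    have inj: "inj (resum m)"
      unfolding m_def
      by (intro inj_resum inj_case_sum inj_scons scons_neq) (auto simp: inj_def double_not_eq_Suc_double)
    have M: "vars e (interleave u v) \<circ> resum m = vars (e 0 ## u) v" for e u v :: "nat \<Rightarrow> 'c"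
      by (rule vars_resum) (auto simp add: m_def scons_def split: nat.split)
    show ?thesis
      unfolding stratified_def
      by (rule exI[of _ "rename (resum m) \<phi>"], rule exI[of _ "interleave \<Gamma> \<delta>"],
          rule exI[of _ "interleave e p"])
        (simp add: stratified_by_rename sat_rename inj M 1)
  qed
  have "stratified (Suc t ## \<Gamma>) (\<lambda>e. \<forall>x. x \<^bold>\<in> e 0 \<longleftrightarrow> P x (\<lambda>i. e (Suc i)))"
  proof (rule stratified_all[of t], rule stratified_iff)
    show "stratified (t ## Suc t ## \<Gamma>) (\<lambda>e. e 0 \<^bold>\<in> e (Suc 0))"
      by (rule stratified_mem_atom) simp
    show "stratified (t ## Suc t ## \<Gamma>) (\<lambda>e. P (e 0) (\<lambda>i. e (Suc (Suc i))))"
      by (rule stratified_weaken_second[OF assms])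
  qed
  then show ?thesis
    unfolding sterm_def
  proof (rule stratified_cong)
    fix e :: "nat \<Rightarrow> 'a"
    show "(\<forall>x. x \<^bold>\<in> e 0 \<longleftrightarrow> P x (\<lambda>i. e (Suc i))) \<longleftrightarrow> e 0 = nfset (\<lambda>x. P x (\<lambda>i. e (Suc i)))"
      using nfset_iff[OF ex, of _ "\<lambda>i. e (Suc i)"] by (metis extensionality)
  qed
qed

lemma sterm_subst:
  assumes "sterm (t ## \<Gamma>) s (\<lambda>e. F (e 0))" "sterm \<Gamma> t f"
  shows "sterm \<Gamma> s (\<lambda>e. F (f e))"
proof -
  have "stratified (s ## t ## s ## \<Gamma>) (\<lambda>e. e 0 = F (e (Suc 0)))"
  proof -
    have i: "inj (0 ## Suc 0 ## (\<lambda>i. Suc (Suc (Suc i))))"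
      by (intro inj_scons scons_neq) (auto simp: inj_def)
    have c: "(s ## t ## s ## \<Gamma>) ((0 ## Suc 0 ## (\<lambda>i. Suc (Suc (Suc i)))) i) = (s ## t ## \<Gamma>) i" for i
      by (intro scons_eqI) simp_all
    show ?thesis
      using stratified_rename[OF assms(1)[unfolded sterm_def] i, of "s ## t ## s ## \<Gamma>", OF c] by simp
  qed
  from stratified_swap[OF this] have "stratified (t ## s ## s ## \<Gamma>) (\<lambda>e. e (Suc 0) = F (e 0))" .
  then show ?thesis
    unfolding sterm_def by (rule stratified_subst2[where P = "\<lambda>a b e. b = F a", OF _ sterm_weaken[OF assms(2)] sterm_var0])
qed

lemma stratified_weaken: "stratified \<Gamma> P \<Longrightarrow> stratified (t ## \<Gamma>) (\<lambda>e. P (\<lambda>i. e (Suc i)))"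
  by (rule stratified_rename[where \<pi> = Suc]) simp_all

lemma sterm_subst2:
  assumes "sterm (t1 ## t2 ## \<Gamma>) s (\<lambda>e. F (e 0) (e (Suc 0)))" "sterm \<Gamma> t1 f" "sterm \<Gamma> t2 g"
  shows "sterm \<Gamma> s (\<lambda>e. F (f e) (g e))"
proof -
  have i: "inj (0 ## Suc 0 ## Suc (Suc 0) ## (\<lambda>i. Suc (Suc (Suc (Suc i)))))"
    by (intro inj_scons scons_neq) (auto simp: inj_def)
  have c: "(s ## t1 ## t2 ## s ## \<Gamma>)
      ((0 ## Suc 0 ## Suc (Suc 0) ## (\<lambda>i. Suc (Suc (Suc (Suc i))))) i) = (s ## t1 ## t2 ## \<Gamma>) i" for i
    by (intro scons_eqI) simp_all
  have "stratified (s ## t1 ## t2 ## s ## \<Gamma>) (\<lambda>e. e 0 = F (e (Suc 0)) (e (Suc (Suc 0))))"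
    using stratified_rename[OF assms(1)[unfolded sterm_def] i, of "s ## t1 ## t2 ## s ## \<Gamma>", OF c] by simp
  from stratified_subst[OF this sterm_var2]
  have "stratified (t1 ## t2 ## s ## \<Gamma>) (\<lambda>e. e (Suc (Suc 0)) = F (e 0) (e (Suc 0)))"
    by simp
  then show ?thesis
    unfolding sterm_def
    by (rule stratified_subst2[where P = "\<lambda>a b e. e 0 = F a b",
          OF _ sterm_weaken[OF assms(2)] sterm_weaken[OF assms(3)]])
qed

lemma sterm_if:
  assumes "stratified \<Gamma> P" "sterm \<Gamma> t f" "sterm \<Gamma> t g"
  shows "sterm \<Gamma> t (\<lambda>e. if P e then f e else g e)"
proof -
  have "stratified (t ## \<Gamma>) (\<lambda>e. (P (\<lambda>i. e (Suc i)) \<and> e 0 = f (\<lambda>i. e (Suc i))) \<or>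
      (\<not> P (\<lambda>i. e (Suc i)) \<and> e 0 = g (\<lambda>i. e (Suc i))))"
    by (intro stratified_disj stratified_conj stratified_not stratified_weaken assms assms[unfolded sterm_def])
  then show ?thesis
    unfolding sterm_def by (rule stratified_cong) simp
qed

text \<open>The constant rules come first, so that a subterm without variables is never taken apart. Each
defined set operation below receives a rule of the same kind, named after the operation.\<close>

lemmas strat = stratified_const sterm_const sterm_vars
  stratified_not stratified_conj stratified_disj stratified_imp stratified_iff
  stratified_ex1 stratified_ex stratified_all stratified_eq stratified_mem sterm_nfset sterm_if

lemma sterm_sing [THEN sterm_subst]: "sterm (t ## \<Gamma>) (Suc t) (\<lambda>e. sing (e 0))"
  unfolding sing_def by (rule strat)+

lemma sterm_union [THEN sterm_subst2]: "sterm (Suc t ## Suc t ## \<Gamma>) (Suc t) (\<lambda>e. union (e 0) (e (Suc 0)))"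
  unfolding union_def by (rule strat)+

lemma eqI: "(\<And>z. z \<^bold>\<in> x \<longleftrightarrow> z \<^bold>\<in> y) \<Longrightarrow> x = y"
  using extensionality by blast

lemma mem_sing [simp]: "x \<^bold>\<in> sing a \<longleftrightarrow> x = a"
  unfolding sing_def by (rule nfset_iff) (rule strat)+

lemma sing_inject [simp]: "sing a = sing b \<longleftrightarrow> a = b"
  by (metis mem_sing)

lemma mem_union [simp]: "x \<^bold>\<in> union a b \<longleftrightarrow> x \<^bold>\<in> a \<or> x \<^bold>\<in> b"
  unfolding union_def by (rule nfset_iff) (rule strat)+

section \<open>Frege numerals and finite sets\<close>

definition emp :: "'a::nf" where "emp = nfset (\<lambda>x. False)"

lemma mem_emp [simp]: "\<not> x \<^bold>\<in> emp"
  unfolding emp_def by (subst nfset_iff; (rule strat)?) simp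

definition univ :: "'a::nf" where "univ = nfset (\<lambda>x. True)"

lemma mem_univ [simp]: "x \<^bold>\<in> univ"
  unfolding univ_def by (subst nfset_iff; (rule strat)?) simp

lemma mem_zero [simp]: "x \<^bold>\<in> zero \<longleftrightarrow> x = emp"
  by (simp add: zero_def emp_def)

definition ins :: "'a::nf \<Rightarrow> 'a \<Rightarrow> 'a" where "ins a u = union u (sing a)"

lemma mem_ins [simp]: "x \<^bold>\<in> ins a u \<longleftrightarrow> x = a \<or> x \<^bold>\<in> u"
  by (auto simp: ins_def)

lemma sterm_ins [THEN sterm_subst2]: "sterm (t ## Suc t ## \<Gamma>) (Suc t) (\<lambda>e. ins (e 0) (e (Suc 0)))"
  unfolding ins_def by (rule strat sterm_sing sterm_union)+

lemma mem_succ: "z \<^bold>\<in> succ n \<longleftrightarrow> (\<exists>x a. x \<^bold>\<in> n \<and> \<not> a \<^bold>\<in> x \<and> z = ins a x)"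
  unfolding succ_def ins_def by (rule nfset_iff) (rule strat sterm_sing sterm_union)+

lemma sterm_succ [THEN sterm_subst]: "sterm (Suc (Suc t) ## \<Gamma>) (Suc (Suc t)) (\<lambda>e. succ (e 0))"
  unfolding succ_def by (rule strat sterm_sing sterm_union)+

lemma mem_Nn: "n \<^bold>\<in> Nn \<longleftrightarrow> (\<forall>I. zero \<^bold>\<in> I \<and> (\<forall>m. m \<^bold>\<in> I \<longrightarrow> succ m \<^bold>\<in> I) \<longrightarrow> n \<^bold>\<in> I)"
  unfolding Nn_def by (rule nfset_iff) (rule strat sterm_succ)+

lemma zero_in_Nn [simp]: "zero \<^bold>\<in> Nn" and succ_in_Nn [simp]: "n \<^bold>\<in> Nn \<Longrightarrow> succ n \<^bold>\<in> Nn"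
  by (auto simp: mem_Nn)

lemma Nn_induct:
  assumes n: "n \<^bold>\<in> Nn" and P: "stratified (t ## \<Gamma>) (\<lambda>e. P (e 0))"
    and "P zero" "\<And>m. m \<^bold>\<in> Nn \<Longrightarrow> P m \<Longrightarrow> P (succ m)"
  shows "P n"
proof -
  define I where "I = nfset (\<lambda>m. m \<^bold>\<in> Nn \<and> P m)"
  have I: "m \<^bold>\<in> I \<longleftrightarrow> m \<^bold>\<in> Nn \<and> P m" for m
    unfolding I_def by (rule nfset_iff) (rule P strat)+
  with n[unfolded mem_Nn, rule_format, of I] assms(3,4) show ?thesis by auto
qed

lemma finite_set_induct:
  assumes n: "n \<^bold>\<in> Nn" and x: "x \<^bold>\<in> n" and P: "stratified (t ## \<Gamma>) (\<lambda>e. P (e 0))"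
    and "P emp" "\<And>u a. \<not> a \<^bold>\<in> u \<Longrightarrow> P u \<Longrightarrow> P (ins a u)"
  shows "P x"
proof -
  have "\<forall>x. x \<^bold>\<in> n \<longrightarrow> P x"
  proof (rule Nn_induct[OF n])
    show "stratified (Suc t ## \<Gamma>) (\<lambda>e. \<forall>x. x \<^bold>\<in> e 0 \<longrightarrow> P x)"
      by (rule strat stratified_weaken_second[OF P])+
  qed (use assms(4,5) in \<open>auto simp: mem_succ\<close>)
  with x show ?thesis by blast
qed

text \<open>Membership in a numeral depends on the number of elements only. If \<open>x\<close> with the new
element \<open>a\<close> equals \<open>x'\<close> with the new element \<open>b\<close>, and \<open>a \<noteq> b\<close>, then
\<open>x\<close> and \<open>x'\<close> arise from a common smaller set by adding \<open>b\<close> and \<open>a\<close>.\<close>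

lemma finite_set_remove:
  fixes n :: "'a::nf"
  assumes n: "n \<^bold>\<in> Nn" and "\<not> a \<^bold>\<in> x" "ins a x \<^bold>\<in> succ n"
  shows "x \<^bold>\<in> n"
proof -
  have "\<forall>x a. \<not> a \<^bold>\<in> x \<and> ins a x \<^bold>\<in> succ n \<longrightarrow> x \<^bold>\<in> n"
  proof (rule Nn_induct[OF n])
    show "stratified (Suc (Suc t) ## \<Gamma>) (\<lambda>e. \<forall>x a. \<not> a \<^bold>\<in> x \<and> ins a x \<^bold>\<in> succ (e 0) \<longrightarrow> x \<^bold>\<in> e 0)" for t \<Gamma>
      by (rule strat sterm_ins sterm_succ)+
    show "\<forall>x a. \<not> a \<^bold>\<in> x \<and> ins a x \<^bold>\<in> succ zero \<longrightarrow> x \<^bold>\<in> (zero::'a)"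
    proof (intro allI impI)
      fix x a :: 'a
      assume *: "\<not> a \<^bold>\<in> x \<and> ins a x \<^bold>\<in> succ zero"
      then obtain b where "ins a x = ins b emp" by (auto simp: mem_succ)
      then have "z \<^bold>\<in> ins a x \<longleftrightarrow> z = b" for z by simp
      with * have "\<not> z \<^bold>\<in> x" for z by (metis mem_ins)
      then show "x \<^bold>\<in> zero" by (auto intro: eqI)
    qed
  next
    fix m :: 'a
    assume IH: "\<forall>x a. \<not> a \<^bold>\<in> x \<and> ins a x \<^bold>\<in> succ m \<longrightarrow> x \<^bold>\<in> m"
    show "\<forall>x a. \<not> a \<^bold>\<in> x \<and> ins a x \<^bold>\<in> succ (succ m) \<longrightarrow> x \<^bold>\<in> succ m"
    proof (intro allI impI)
      fix x a :: 'a
      assume *: "\<not> a \<^bold>\<in> x \<and> ins a x \<^bold>\<in> succ (succ m)"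
      then obtain x' b where x': "x' \<^bold>\<in> succ m" "\<not> b \<^bold>\<in> x'" "ins a x = ins b x'"
        by (auto simp: mem_succ[of _ "succ m"])
      then have eq: "z = a \<or> z \<^bold>\<in> x \<longleftrightarrow> z = b \<or> z \<^bold>\<in> x'" for z by (metis mem_ins)
      show "x \<^bold>\<in> succ m"
      proof (cases "a = b")
        case True
        then have "x = x'" using eq * x'(2) by (intro eqI) metis
        then show ?thesis using x'(1) by simp
      next
        case False
        define y where "y = nfset (\<lambda>z. z \<^bold>\<in> x' \<and> z \<noteq> a)"
        have y: "z \<^bold>\<in> y \<longleftrightarrow> z \<^bold>\<in> x' \<and> z \<noteq> a" for z
          unfolding y_def by (rule nfset_iff) (rule strat)+
        have "x' = ins a y" using eq[of a] False by (intro eqI) (auto simp: y)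
        then have "y \<^bold>\<in> m" using IH x'(1) y by blast
        moreover have "x = ins b y"
        proof (rule eqI)
          show "z \<^bold>\<in> x \<longleftrightarrow> z \<^bold>\<in> ins b y" for z using eq[of z] eq[of b] * False by (auto simp: y)
        qed
        ultimately show ?thesis using y x'(2) by (auto simp: mem_succ)
      qed
    qed
  qed
  with assms show ?thesis by blast
qed

section \<open>Equipotence\<close>

definition subset :: "'a::nf \<Rightarrow> 'a \<Rightarrow> bool"  (infix "\<sqsubseteq>" 50) where
  "x \<sqsubseteq> y \<longleftrightarrow> (\<forall>z. z \<^bold>\<in> x \<longrightarrow> z \<^bold>\<in> y)"

lemma stratified_subset [THEN stratified_subst2[where P = "\<lambda>x y e. x \<sqsubseteq> y"]]:
  "stratified (Suc t ## Suc t ## \<Gamma>) (\<lambda>e. e 0 \<sqsubseteq> e (Suc 0))"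
  unfolding subset_def by (rule strat)+

text \<open>Kuratowski pairs code bijections here, since injectivity of Quine pairs is a consequence of the
axiom of infinity, which these bijections serve to prove. They sit two types above their
components, which is harmless because equipotence quantifies over the coding set.\<close>

definition kpair :: "'a::nf \<Rightarrow> 'a \<Rightarrow> 'a" where
  "kpair a b = union (sing (sing a)) (sing (union (sing a) (sing b)))"

lemma sterm_kpair [THEN sterm_subst2]:
  "sterm (t ## t ## \<Gamma>) (Suc (Suc t)) (\<lambda>e. kpair (e 0) (e (Suc 0)))"
  unfolding kpair_def by (rule strat sterm_sing sterm_union)+

lemma kpair_inject [simp]: "kpair a b = kpair c d \<longleftrightarrow> a = c \<and> b = d"
proof
  assume "kpair a b = kpair c d"
  then have 1: "z = sing a \<or> z = union (sing a) (sing b) \<longleftrightarrow> z = sing c \<or> z = union (sing c) (sing d)" for z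
    by (metis kpair_def mem_sing mem_union)
  have 2: "sing x = union (sing y) (sing z) \<longleftrightarrow> x = y \<and> y = z" for x y z :: 'a
    by (metis mem_sing mem_union eqI)
  have 3: "union (sing x) (sing y) = union (sing x) (sing z) \<longleftrightarrow> y = z" for x y z :: 'a
    by (metis mem_sing mem_union)
  have "a = c" using 1[of "sing a"] 2[of a c d] by auto
  moreover have "b = d" using 1[of "union (sing a) (sing b)"] 1[of "union (sing c) (sing d)"] 2 3 \<open>a = c\<close>
    by metis
  ultimately show "a = c \<and> b = d" ..
qed simp

text \<open>The relation restricts to a bijection from the members of \<open>x\<close> to those of \<open>y\<close>.\<close>

definition matches :: "('a::nf \<Rightarrow> 'a \<Rightarrow> bool) \<Rightarrow> 'a \<Rightarrow> 'a \<Rightarrow> bool" where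
  "matches r x y \<longleftrightarrow> (\<forall>a. a \<^bold>\<in> x \<longrightarrow> (\<exists>b. b \<^bold>\<in> y \<and> r a b)) \<and> (\<forall>b. b \<^bold>\<in> y \<longrightarrow> (\<exists>a. a \<^bold>\<in> x \<and> r a b)) \<and>
    (\<forall>a b a' b'. a \<^bold>\<in> x \<and> a' \<^bold>\<in> x \<and> b \<^bold>\<in> y \<and> b' \<^bold>\<in> y \<and> r a b \<and> r a' b' \<longrightarrow> (a = a' \<longleftrightarrow> b = b'))"

definition equipotent :: "'a::nf \<Rightarrow> 'a \<Rightarrow> bool"  (infix "\<approx>" 50) where
  "x \<approx> y \<longleftrightarrow> (\<exists>f. matches (\<lambda>a b. kpair a b \<^bold>\<in> f) x y)"

lemma stratified_equipotent [THEN stratified_subst2[where P = "\<lambda>x y e. x \<approx> y"]]: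
  "stratified (Suc t ## Suc t ## \<Gamma>) (\<lambda>e. e 0 \<approx> e (Suc 0))"
  unfolding equipotent_def matches_def by (rule strat sterm_kpair)+

lemma equipotentI:
  assumes r: "stratified (t ## t ## Suc (Suc t) ## \<Gamma>) (\<lambda>e. r (e (Suc 0)) (e 0))" and m: "matches r x y"
  shows "x \<approx> y"
proof -
  define f where "f = nfset (\<lambda>p. \<exists>a b. p = kpair a b \<and> r a b)"
  have "p \<^bold>\<in> f \<longleftrightarrow> (\<exists>a b. p = kpair a b \<and> r a b)" for p
    unfolding f_def by (rule nfset_iff) (rule strat sterm_kpair r)+
  then have "(\<lambda>a b. kpair a b \<^bold>\<in> f) = r"
    by (auto simp: fun_eq_iff)
  with m show ?thesis
    unfolding equipotent_def by metis
qed

lemma mem_T [simp]: "z \<^bold>\<in> T X \<longleftrightarrow> (\<exists>x. x \<^bold>\<in> X \<and> z = sing x)"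
  unfolding T_def by (rule nfset_iff) (rule strat sterm_sing)+

lemma sterm_T [THEN sterm_subst]: "sterm (Suc t ## \<Gamma>) (Suc (Suc t)) (\<lambda>e. T (e 0))"
  unfolding T_def by (rule strat sterm_sing)+

definition Pow :: "'a::nf \<Rightarrow> 'a" where "Pow x = nfset (\<lambda>z. z \<sqsubseteq> x)"

lemma mem_Pow [simp]: "z \<^bold>\<in> Pow x \<longleftrightarrow> z \<sqsubseteq> x"
  unfolding Pow_def by (rule nfset_iff) (rule strat stratified_subset)+

lemma sterm_Pow [THEN sterm_subst]: "sterm (Suc t ## \<Gamma>) (Suc (Suc t)) (\<lambda>e. Pow (e 0))"
  unfolding Pow_def by (rule strat stratified_subset)+

lemma matchesI:
  assumes "\<And>a. a \<^bold>\<in> x \<Longrightarrow> \<exists>b. b \<^bold>\<in> y \<and> r a b" "\<And>b. b \<^bold>\<in> y \<Longrightarrow> \<exists>a. a \<^bold>\<in> x \<and> r a b"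
    and "\<And>a b a' b'. \<lbrakk>a \<^bold>\<in> x; a' \<^bold>\<in> x; b \<^bold>\<in> y; b' \<^bold>\<in> y; r a b; r a' b'\<rbrakk> \<Longrightarrow> a = a' \<longleftrightarrow> b = b'"
  shows "matches r x y"
  unfolding matches_def using assms by simp

lemma matches_left: "matches r x y \<Longrightarrow> a \<^bold>\<in> x \<Longrightarrow> \<exists>b. b \<^bold>\<in> y \<and> r a b"
  and matches_right: "matches r x y \<Longrightarrow> b \<^bold>\<in> y \<Longrightarrow> \<exists>a. a \<^bold>\<in> x \<and> r a b"
  and matches_inj: "matches r x y \<Longrightarrow> a \<^bold>\<in> x \<Longrightarrow> a' \<^bold>\<in> x \<Longrightarrow> b \<^bold>\<in> y \<Longrightarrow> b' \<^bold>\<in> y \<Longrightarrow>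
    r a b \<Longrightarrow> r a' b' \<Longrightarrow> a = a' \<longleftrightarrow> b = b'"
  by (simp_all add: matches_def)

lemma matches_sym: "matches r x y \<Longrightarrow> matches (\<lambda>a b. r b a) y x"
  unfolding matches_def by blast

lemma equipotent_refl: "x \<approx> x"
proof (rule equipotentI)
  show "matches (=) x x" by (rule matchesI) auto
qed (rule strat)+

lemma equipotent_sym:
  assumes "x \<approx> y"
  shows "y \<approx> x"
proof -
  obtain f where "matches (\<lambda>a b. kpair a b \<^bold>\<in> f) x y"
    using assms by (auto simp: equipotent_def)
  from matches_sym[OF this] show ?thesis
    by (rule equipotentI[rotated]) (rule strat sterm_kpair)+
qed

lemma equipotent_trans:
  assumes "x \<approx> y" "y \<approx> z"
  shows "x \<approx> z"
proof -
  obtain f g where f: "matches (\<lambda>a b. kpair a b \<^bold>\<in> f) x y" and g: "matches (\<lambda>a b. kpair a b \<^bold>\<in> g) y z"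
    using assms by (auto simp: equipotent_def)
  show ?thesis
  proof (rule equipotentI)
    show "matches (\<lambda>a c. \<exists>b. b \<^bold>\<in> y \<and> kpair a b \<^bold>\<in> f \<and> kpair b c \<^bold>\<in> g) x z"
      (is "matches ?r x z")
    proof (rule matchesI)
      show "\<exists>c. c \<^bold>\<in> z \<and> ?r a c" if "a \<^bold>\<in> x" for a
        using matches_left[OF f that] matches_left[OF g] by blast
      show "\<exists>a. a \<^bold>\<in> x \<and> ?r a c" if "c \<^bold>\<in> z" for c
        using matches_right[OF g that] matches_right[OF f] by blast
      fix a c a' c'
      assume *: "a \<^bold>\<in> x" "a' \<^bold>\<in> x" "c \<^bold>\<in> z" "c' \<^bold>\<in> z" and "?r a c" "?r a' c'"
      then obtain b b' where b: "b \<^bold>\<in> y" "kpair a b \<^bold>\<in> f" "kpair b c \<^bold>\<in> g"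
        and b': "b' \<^bold>\<in> y" "kpair a' b' \<^bold>\<in> f" "kpair b' c' \<^bold>\<in> g" by blast
      show "a = a' \<longleftrightarrow> c = c'"
        using matches_inj[OF f *(1,2) b(1) b'(1) b(2) b'(2)] matches_inj[OF g b(1) b'(1) *(3,4) b(3) b'(3)]
        by simp
    qed
  qed (rule strat sterm_kpair)+
qed

lemma equipotent_T:
  assumes "x \<approx> y"
  shows "T x \<approx> T y"
proof -
  obtain f where f: "matches (\<lambda>a b. kpair a b \<^bold>\<in> f) x y"
    using assms by (auto simp: equipotent_def)
  show ?thesis
  proof (rule equipotentI)
    show "matches (\<lambda>p q. \<exists>a b. p = sing a \<and> q = sing b \<and> kpair a b \<^bold>\<in> f) (T x) (T y)"
    proof (rule matchesI)
      show "\<exists>q. q \<^bold>\<in> T y \<and> (\<exists>a b. p = sing a \<and> q = sing b \<and> kpair a b \<^bold>\<in> f)" if "p \<^bold>\<in> T x" for p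
        using that matches_left[OF f] unfolding mem_T by blast
      show "\<exists>p. p \<^bold>\<in> T x \<and> (\<exists>a b. p = sing a \<and> q = sing b \<and> kpair a b \<^bold>\<in> f)" if "q \<^bold>\<in> T y" for q
        using that matches_right[OF f] unfolding mem_T by blast
    qed (auto dest: matches_inj[OF f])
  qed (rule strat sterm_kpair sterm_sing)+
qed

lemma equipotent_T_D:
  assumes "T x \<approx> T y"
  shows "x \<approx> y"
proof -
  obtain f where f: "matches (\<lambda>a b. kpair a b \<^bold>\<in> f) (T x) (T y)"
    using assms by (auto simp: equipotent_def)
  show ?thesis
  proof (rule equipotentI)
    show "matches (\<lambda>a b. kpair (sing a) (sing b) \<^bold>\<in> f) x y"
    proof (rule matchesI)
      show "\<exists>b. b \<^bold>\<in> y \<and> kpair (sing a) (sing b) \<^bold>\<in> f" if "a \<^bold>\<in> x" for a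
        using that matches_left[OF f, of "sing a"] by auto
      show "\<exists>a. a \<^bold>\<in> x \<and> kpair (sing a) (sing b) \<^bold>\<in> f" if "b \<^bold>\<in> y" for b
        using that matches_right[OF f, of "sing b"] by auto
      show "a = a' \<longleftrightarrow> b = b'" if "a \<^bold>\<in> x" "a' \<^bold>\<in> x" "b \<^bold>\<in> y" "b' \<^bold>\<in> y"
        "kpair (sing a) (sing b) \<^bold>\<in> f" "kpair (sing a') (sing b') \<^bold>\<in> f" for a b a' b'
        using that matches_inj[OF f, of "sing a" "sing a'" "sing b" "sing b'"] by auto
    qed
  qed (rule strat sterm_kpair sterm_sing)+
qed

lemma subset_antisym: "x \<sqsubseteq> y \<Longrightarrow> y \<sqsubseteq> x \<Longrightarrow> x = y"
  unfolding subset_def by (blast intro: eqI)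

lemma equipotent_subset:
  assumes "x \<approx> y" "u \<sqsubseteq> x"
  obtains v where "v \<sqsubseteq> y" "u \<approx> v" "v = y \<Longrightarrow> u = x"
proof -
  obtain f where f: "matches (\<lambda>a b. kpair a b \<^bold>\<in> f) x y"
    using assms by (auto simp: equipotent_def)
  define v where "v = nfset (\<lambda>b. b \<^bold>\<in> y \<and> (\<exists>a. a \<^bold>\<in> u \<and> kpair a b \<^bold>\<in> f))"
  have v: "b \<^bold>\<in> v \<longleftrightarrow> b \<^bold>\<in> y \<and> (\<exists>a. a \<^bold>\<in> u \<and> kpair a b \<^bold>\<in> f)" for b
    unfolding v_def by (rule nfset_iff) (rule strat sterm_kpair)+
  show ?thesis
  proof
    show "v \<sqsubseteq> y" by (simp add: subset_def v)
    have "matches (\<lambda>a b. kpair a b \<^bold>\<in> f) u v"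
    proof (rule matchesI)
      show "\<exists>b. b \<^bold>\<in> v \<and> kpair a b \<^bold>\<in> f" if "a \<^bold>\<in> u" for a
        using that matches_left[OF f, of a] assms(2) v unfolding subset_def by blast
    qed (use assms(2) matches_inj[OF f] in \<open>simp add: v subset_def; blast\<close>)+
    then show "u \<approx> v" by (auto simp: equipotent_def)
    assume "v = y"
    have "x \<sqsubseteq> u"
      unfolding subset_def
    proof (intro allI impI)
      fix a assume a: "a \<^bold>\<in> x"
      then obtain b where b: "b \<^bold>\<in> y" "kpair a b \<^bold>\<in> f" using matches_left[OF f] by blast
      then obtain a' where "a' \<^bold>\<in> u" "kpair a' b \<^bold>\<in> f" using v \<open>v = y\<close> by blast
      then show "a \<^bold>\<in> u"
        using matches_inj[OF f a _ b(1) b(1) b(2), of a'] assms(2) unfolding subset_def by blast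
    qed
    with assms(2) show "u = x" by (rule subset_antisym)
  qed
qed

text \<open>Subsets correspond when they agree along the given bijection.\<close>

lemma equipotent_Pow:
  assumes "x \<approx> y"
  shows "Pow x \<approx> Pow y"
proof -
  obtain f where f: "matches (\<lambda>a b. kpair a b \<^bold>\<in> f) x y"
    using assms by (auto simp: equipotent_def)
  let ?r = "\<lambda>u v. \<forall>a b. a \<^bold>\<in> x \<and> b \<^bold>\<in> y \<and> kpair a b \<^bold>\<in> f \<longrightarrow> (a \<^bold>\<in> u \<longleftrightarrow> b \<^bold>\<in> v)"
  show ?thesis
  proof (rule equipotentI)
    show "stratified (Suc t ## Suc t ## Suc (Suc (Suc t)) ## \<Gamma>) (\<lambda>e. ?r (e (Suc 0)) (e 0))" for t \<Gamma>
      by (rule strat sterm_kpair)+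
    have 1: "\<exists>v. v \<sqsubseteq> y \<and> ?r u v" if "u \<sqsubseteq> x" for u
    proof -
      define v where "v = nfset (\<lambda>b. b \<^bold>\<in> y \<and> (\<exists>a. a \<^bold>\<in> x \<and> a \<^bold>\<in> u \<and> kpair a b \<^bold>\<in> f))"
      have "b \<^bold>\<in> v \<longleftrightarrow> b \<^bold>\<in> y \<and> (\<exists>a. a \<^bold>\<in> x \<and> a \<^bold>\<in> u \<and> kpair a b \<^bold>\<in> f)" for b
        unfolding v_def by (rule nfset_iff) (rule strat sterm_kpair)+
      then show ?thesis
        using matches_inj[OF f] by (intro exI[of _ v]) (simp add: subset_def; blast)
    qed
    have 2: "\<exists>u. u \<sqsubseteq> x \<and> ?r u v" if "v \<sqsubseteq> y" for v
    proof -
      define u where "u = nfset (\<lambda>a. a \<^bold>\<in> x \<and> (\<exists>b. b \<^bold>\<in> y \<and> b \<^bold>\<in> v \<and> kpair a b \<^bold>\<in> f))"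
      have "a \<^bold>\<in> u \<longleftrightarrow> a \<^bold>\<in> x \<and> (\<exists>b. b \<^bold>\<in> y \<and> b \<^bold>\<in> v \<and> kpair a b \<^bold>\<in> f)" for a
        unfolding u_def by (rule nfset_iff) (rule strat sterm_kpair)+
      then show ?thesis
        using matches_inj[OF f] by (intro exI[of _ u]) (simp add: subset_def; blast)
    qed
    have 3: "u = u' \<longleftrightarrow> v = v'" if "u \<sqsubseteq> x" "u' \<sqsubseteq> x" "v \<sqsubseteq> y" "v' \<sqsubseteq> y" "?r u v" "?r u' v'" for u u' v v'
    proof
      assume "u = u'"
      show "v = v'"
      proof (rule eqI)
        fix b
        show "b \<^bold>\<in> v \<longleftrightarrow> b \<^bold>\<in> v'"
        proof (cases "b \<^bold>\<in> y")
          case True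
          then obtain a where "a \<^bold>\<in> x" "kpair a b \<^bold>\<in> f" using matches_right[OF f] by blast
          with True that(5,6) \<open>u = u'\<close> show ?thesis by blast
        next
          case False
          with that(3,4) show ?thesis unfolding subset_def by blast
        qed
      qed
    next
      assume "v = v'"
      show "u = u'"
      proof (rule eqI)
        fix a
        show "a \<^bold>\<in> u \<longleftrightarrow> a \<^bold>\<in> u'"
        proof (cases "a \<^bold>\<in> x")
          case True
          then obtain b where "b \<^bold>\<in> y" "kpair a b \<^bold>\<in> f" using matches_left[OF f] by blast
          with True that(5,6) \<open>v = v'\<close> show ?thesis by blast
        next
          case False
          with that(1,2) show ?thesis unfolding subset_def by blast
        qed
      qed
    qed
    show "matches ?r (Pow x) (Pow y)"
      unfolding mem_Pow by (rule matchesI; unfold mem_Pow) (rule 1 2 3; assumption)+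
  qed
qed

text \<open>The correspondence sends the singleton of \<open>u\<close> to \<open>T u\<close>; both are one type above \<open>u\<close>,
so it is a set.\<close>

lemma equipotent_T_Pow: "T (Pow x) \<approx> Pow (T x)"
proof (rule equipotentI)
  let ?r = "\<lambda>p q. \<exists>u. p = sing u \<and> q = T u"
  show "stratified (Suc (Suc t) ## Suc (Suc t) ## Suc (Suc (Suc (Suc t))) ## \<Gamma>) (\<lambda>e. ?r (e (Suc 0)) (e 0))" for t \<Gamma>
    by (rule strat sterm_sing sterm_T)+
  have inj: "T u = T v \<longleftrightarrow> u = v" for u v :: 'a
    by (metis mem_T sing_inject eqI)
  have "\<exists>u. u \<sqsubseteq> x \<and> v = T u" if "v \<sqsubseteq> T x" for v
  proof -
    define u where "u = nfset (\<lambda>a. sing a \<^bold>\<in> v)"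
    have u: "a \<^bold>\<in> u \<longleftrightarrow> sing a \<^bold>\<in> v" for a
      unfolding u_def by (rule nfset_iff) (rule strat sterm_sing)+
    have "v = T u"
      using that by (intro eqI) (auto simp: u subset_def)
    moreover have "u \<sqsubseteq> x"
      using that by (auto simp: u subset_def)
    ultimately show ?thesis by blast
  qed
  note 1 = this
  have 2: "T u \<sqsubseteq> T x" if "u \<sqsubseteq> x" for u
    using that by (auto simp: subset_def)
  show "matches ?r (T (Pow x)) (Pow (T x))"
  proof (rule matchesI)
    show "\<exists>q. q \<^bold>\<in> Pow (T x) \<and> ?r p q" if "p \<^bold>\<in> T (Pow x)" for p
      using that 2 by auto
    show "\<exists>p. p \<^bold>\<in> T (Pow x) \<and> ?r p q" if "q \<^bold>\<in> Pow (T x)" for q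
      using 1[of q] that by (metis mem_Pow mem_T)
  qed (auto simp: inj)
qed

lemma equipotent_ins:
  assumes "x \<approx> y" "\<not> a \<^bold>\<in> x" "\<not> b \<^bold>\<in> y"
  shows "ins a x \<approx> ins b y"
proof -
  obtain f where f: "matches (\<lambda>a b. kpair a b \<^bold>\<in> f) x y"
    using assms by (auto simp: equipotent_def)
  show ?thesis
  proof (rule equipotentI)
    show "matches (\<lambda>p q. (p \<^bold>\<in> x \<and> q \<^bold>\<in> y \<and> kpair p q \<^bold>\<in> f) \<or> (p = a \<and> q = b)) (ins a x) (ins b y)"
      (is "matches ?r _ _")
    proof (rule matchesI)
      show "\<exists>q. q \<^bold>\<in> ins b y \<and> ?r p q" if "p \<^bold>\<in> ins a x" for p
        using that matches_left[OF f, of p] by auto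
      show "\<exists>p. p \<^bold>\<in> ins a x \<and> ?r p q" if "q \<^bold>\<in> ins b y" for q
        using that matches_right[OF f, of q] by auto
      show "p = p' \<longleftrightarrow> q = q'" if "?r p q" "?r p' q'" for p q p' q'
        using that matches_inj[OF f, of p p' q q'] assms(2,3) by blast
    qed
  qed (rule strat sterm_kpair)+
qed

text \<open>The partners of \<open>a\<close> and \<open>b\<close> are matched with each other.\<close>

lemma equipotent_remove:
  assumes "ins a x \<approx> ins b y" "\<not> a \<^bold>\<in> x" "\<not> b \<^bold>\<in> y"
  shows "x \<approx> y"
proof -
  obtain f where f: "matches (\<lambda>a b. kpair a b \<^bold>\<in> f) (ins a x) (ins b y)"
    using assms by (auto simp: equipotent_def)
  show ?thesis
  proof (rule equipotentI)
    show "matches (\<lambda>p q. kpair p q \<^bold>\<in> f \<or> (kpair p b \<^bold>\<in> f \<and> kpair a q \<^bold>\<in> f)) x y"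
      (is "matches ?r x y")
    proof (rule matchesI)
      show "\<exists>q. q \<^bold>\<in> y \<and> ?r p q" if "p \<^bold>\<in> x" for p
      proof -
        from that obtain q where q: "q \<^bold>\<in> ins b y" "kpair p q \<^bold>\<in> f"
          using matches_left[OF f, of p] by auto
        obtain q' where q': "q' \<^bold>\<in> ins b y" "kpair a q' \<^bold>\<in> f"
          using matches_left[OF f, of a] by auto
        show ?thesis
          using matches_inj[OF f, of p a q q'] q q' that assms(2) by auto
      qed
      show "\<exists>p. p \<^bold>\<in> x \<and> ?r p q" if "q \<^bold>\<in> y" for q
      proof -
        from that obtain p where p: "p \<^bold>\<in> ins a x" "kpair p q \<^bold>\<in> f"
          using matches_right[OF f, of q] by auto
        obtain p' where p': "p' \<^bold>\<in> ins a x" "kpair p' b \<^bold>\<in> f"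
          using matches_right[OF f, of b] by auto
        show ?thesis
          using matches_inj[OF f, of p p' q b] p p' that assms(3) by auto
      qed
      fix p q p' q'
      assume *: "p \<^bold>\<in> x" "p' \<^bold>\<in> x" "q \<^bold>\<in> y" "q' \<^bold>\<in> y" and "?r p q" "?r p' q'"
      then have m: "p \<^bold>\<in> ins a x" "p' \<^bold>\<in> ins a x" "a \<^bold>\<in> ins a x" "q \<^bold>\<in> ins b y" "q' \<^bold>\<in> ins b y" "b \<^bold>\<in> ins b y"
        by simp_all
      have ne: "p \<noteq> a" "p' \<noteq> a" "q \<noteq> b" "q' \<noteq> b"
        using * assms(2,3) by auto
      from \<open>?r p q\<close> \<open>?r p' q'\<close> show "p = p' \<longleftrightarrow> q = q'"
      proof (elim disjE conjE)
        assume "kpair p q \<^bold>\<in> f" "kpair p' q' \<^bold>\<in> f"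
        from matches_inj[OF f m(1,2,4,5) this] show ?thesis .
      next
        assume "kpair p q \<^bold>\<in> f" "kpair p' b \<^bold>\<in> f" "kpair a q' \<^bold>\<in> f"
        then show ?thesis
          using matches_inj[OF f m(1,2,4,6)] matches_inj[OF f m(1,3,4,5)] ne by blast
      next
        assume "kpair p b \<^bold>\<in> f" "kpair a q \<^bold>\<in> f" "kpair p' q' \<^bold>\<in> f"
        then show ?thesis
          using matches_inj[OF f m(1,2,6,5)] matches_inj[OF f m(3,2,4,5)] ne by blast
      next
        assume "kpair p b \<^bold>\<in> f" "kpair a q \<^bold>\<in> f" "kpair p' b \<^bold>\<in> f" "kpair a q' \<^bold>\<in> f"
        then show ?thesis
          using matches_inj[OF f m(1,2,6,6)] matches_inj[OF f m(3,3,4,5)] by blast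
      qed
    qed
  qed (rule strat sterm_kpair)+
qed

lemma equipotent_emp: "x \<approx> emp \<Longrightarrow> x = emp"
  by (auto simp: equipotent_def matches_def intro: eqI)

section \<open>The axiom of infinity\<close>

lemma subset_refl [simp]: "x \<sqsubseteq> x"
  by (simp add: subset_def)

text \<open>The argument is by contradiction. In a finite universe every set is finite, and cardinal arithmetic
is that of the natural numbers. Write \<open>|x|\<close> for the cardinality of \<open>x\<close> and
\<open>t |x| = |T x|\<close>. The universe equals its own power set, so \<open>n = |univ|\<close> satisfies
\<open>n = 2 ^ t n\<close>. Applying the binary logarithm to \<open>n\<close> is therefore the same as applying
\<open>t\<close>. Let the height of a number be how often the logarithm can be applied before it leaves
the powers of 2. The parity of the height is defined by a stratified condition, so \<open>t\<close>
preserves it; but taking a logarithm reverses it. Hence \<open>t n\<close> and \<open>n\<close> have heights of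
equal and of opposite parity.\<close>

locale finite_universe =
  fixes N :: "'a::nf"
  assumes N: "N \<^bold>\<in> Nn" and univ_in_N: "univ \<^bold>\<in> N"
begin

text \<open>Induction along the construction of the universe yields the claim for all its subsets, that is, for
all sets.\<close>

lemma universe_induct:
  fixes P :: "'a \<Rightarrow> bool"
  assumes P: "stratified (Suc t ## \<Gamma>) (\<lambda>e. P (e 0))"
    and emp: "P emp" and ins: "\<And>u a. \<not> a \<^bold>\<in> u \<Longrightarrow> P u \<Longrightarrow> P (ins a u)"
  shows "P x"
proof -
  have "\<forall>y. y \<sqsubseteq> univ \<longrightarrow> P y"
  proof (rule finite_set_induct[OF N univ_in_N, where P = "\<lambda>x. \<forall>y. y \<sqsubseteq> x \<longrightarrow> P y"])
    show "stratified (Suc t ## \<Gamma>) (\<lambda>e. \<forall>y. y \<sqsubseteq> e 0 \<longrightarrow> P y)"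
      by (rule strat stratified_subset stratified_weaken_second[OF P])+
    have "y = emp" if "y \<sqsubseteq> emp" for y :: 'a
      using that by (intro eqI) (simp add: subset_def)
    then show "\<forall>y::'a. y \<sqsubseteq> emp \<longrightarrow> P y"
      using emp by metis
    fix u a :: 'a
    assume a: "\<not> a \<^bold>\<in> u" and IH: "\<forall>y. y \<sqsubseteq> u \<longrightarrow> P y"
    show "\<forall>y. y \<sqsubseteq> ins a u \<longrightarrow> P y"
    proof (intro allI impI)
      fix y assume y: "y \<sqsubseteq> ins a u"
      define y' where "y' = nfset (\<lambda>z. z \<^bold>\<in> y \<and> z \<noteq> a)"
      have y': "z \<^bold>\<in> y' \<longleftrightarrow> z \<^bold>\<in> y \<and> z \<noteq> a" for z
        unfolding y'_def by (rule nfset_iff) (rule strat)+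
      have "y' \<sqsubseteq> u" using y by (auto simp: subset_def y')
      then have "P y'" "\<not> a \<^bold>\<in> y'" using IH by (auto simp: y')
      then have "P (ins a y')" by (intro ins)
      moreover have "y = (if a \<^bold>\<in> y then ins a y' else y')"
        by (rule eqI) (auto simp: y')
      ultimately show "P y" using \<open>P y'\<close> by metis
    qed
  qed
  then show ?thesis by (simp add: subset_def)
qed

lemma remove_exists:
  assumes "a \<^bold>\<in> x"
  obtains y where "\<not> a \<^bold>\<in> y" "x = ins a y"
proof
  define y where "y = nfset (\<lambda>z. z \<^bold>\<in> x \<and> z \<noteq> a)"
  have y: "z \<^bold>\<in> y \<longleftrightarrow> z \<^bold>\<in> x \<and> z \<noteq> a" for z
    unfolding y_def by (rule nfset_iff) (rule strat)+
  show "\<not> a \<^bold>\<in> y" by (simp add: y)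
  show "x = ins a y" using assms by (intro eqI) (auto simp: y)
qed

text \<open>Remove \<open>a\<close> on the left and, on the right, either \<open>a\<close> as well or any element at all when
\<open>y\<close> lacks \<open>a\<close>. What remains of \<open>y\<close> lies in \<open>u\<close>, so the induction hypothesis
applies.\<close>

lemma dedekind_finite:
  fixes x y :: 'a
  assumes "y \<sqsubseteq> x" "x \<approx> y"
  shows "y = x"
proof -
  have "\<forall>y. y \<sqsubseteq> x \<and> x \<approx> y \<longrightarrow> y = x"
  proof (rule universe_induct[where P = "\<lambda>x. \<forall>y. y \<sqsubseteq> x \<and> x \<approx> y \<longrightarrow> y = x"])
    show "stratified (Suc t ## \<Gamma>) (\<lambda>e. \<forall>y::'a. y \<sqsubseteq> e 0 \<and> e 0 \<approx> y \<longrightarrow> y = e 0)" for t \<Gamma>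
      by (rule strat stratified_subset stratified_equipotent)+
    show "\<forall>y::'a. y \<sqsubseteq> emp \<and> emp \<approx> y \<longrightarrow> y = emp"
      by (auto intro: equipotent_emp equipotent_sym)
    fix u a :: 'a
    assume a: "\<not> a \<^bold>\<in> u" and IH: "\<forall>y. y \<sqsubseteq> u \<and> u \<approx> y \<longrightarrow> y = u"
    show "\<forall>y. y \<sqsubseteq> ins a u \<and> ins a u \<approx> y \<longrightarrow> y = ins a u"
    proof (intro allI impI)
      fix y assume y: "y \<sqsubseteq> ins a u \<and> ins a u \<approx> y"
      have "y \<noteq> emp" using y equipotent_emp mem_ins mem_emp by metis
      then obtain b' where "b' \<^bold>\<in> y" using eqI[of y emp] by auto
      define b where "b = (if a \<^bold>\<in> y then a else b')"
      have b: "b \<^bold>\<in> y" using \<open>b' \<^bold>\<in> y\<close> by (simp add: b_def)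
      obtain y' where y': "\<not> b \<^bold>\<in> y'" "y = ins b y'" using remove_exists[OF b] .
      have "ins a u \<approx> ins b y'" using y y'(2) by simp
      then have "u \<approx> y'" using a y'(1) by (rule equipotent_remove)
      moreover have "y' \<sqsubseteq> u"
        unfolding subset_def
      proof (intro allI impI)
        fix z assume z: "z \<^bold>\<in> y'"
        then have "z \<^bold>\<in> y" "z \<noteq> b" using y' by auto
        then show "z \<^bold>\<in> u" using y unfolding subset_def b_def by (cases "z = a") auto
      qed
      ultimately have "y' = u" using IH by blast
      moreover have "b = a"
        using y y'(1) b \<open>y' = u\<close> unfolding subset_def by auto
      ultimately show "y = ins a u" using y' by simp
    qed
  qed
  with assms show ?thesis by blast
qed

text \<open>Every set is at most as large as \<open>T univ\<close>, and then of the size of some \<open>T z'\<close>, or at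
least as large. This comparability follows by growing
\<open>z'\<close> along with the given set until it exhausts the universe.\<close>

lemma compare_T_univ: "(\<exists>z'. z \<approx> T z') \<or> (\<exists>u. u \<sqsubseteq> z \<and> u \<approx> T (univ::'a))"
proof (rule universe_induct[where P = "\<lambda>z. (\<exists>z'. z \<approx> T z') \<or> (\<exists>u. u \<sqsubseteq> z \<and> u \<approx> T (univ::'a))"])
  show "stratified (Suc (Suc t) ## \<Gamma>) (\<lambda>e. (\<exists>z'. e 0 \<approx> T z') \<or> (\<exists>u. u \<sqsubseteq> e 0 \<and> u \<approx> T (univ::'a)))" for t \<Gamma>
    by (rule strat stratified_subset stratified_equipotent sterm_T)+
  have "T (emp::'a) = emp" by (rule eqI) simp
  then show "(\<exists>z'. (emp::'a) \<approx> T z') \<or> (\<exists>u. u \<sqsubseteq> emp \<and> u \<approx> T (univ::'a))"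
    by (metis equipotent_refl)
next
  fix u a :: 'a
  assume a: "\<not> a \<^bold>\<in> u" and "(\<exists>z'. u \<approx> T z') \<or> (\<exists>v. v \<sqsubseteq> u \<and> v \<approx> T (univ::'a))"
  then show "(\<exists>z'. ins a u \<approx> T z') \<or> (\<exists>v. v \<sqsubseteq> ins a u \<and> v \<approx> T (univ::'a))"
  proof (elim disjE exE conjE)
    fix z' assume z': "u \<approx> T z'"
    show ?thesis
    proof (cases "z' = univ")
      case True
      with z' show ?thesis by (intro disjI2 exI[of _ u]) (simp add: subset_def)
    next
      case False
      then obtain b where b: "\<not> b \<^bold>\<in> z'" by (metis eqI mem_univ)
      have "ins (sing b) (T z') = T (ins b z')" by (rule eqI) auto
      then have "ins a u \<approx> T (ins b z')"
        using equipotent_ins[OF z' a, of "sing b"] b by simp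
      then show ?thesis by blast
    qed
  next
    fix v assume "v \<sqsubseteq> u" "v \<approx> T (univ::'a)"
    then show ?thesis by (intro disjI2 exI[of _ v]) (simp add: subset_def)
  qed
qed

text \<open>Cardinality \<open>2 ^ |z|\<close> belongs to a set one type above \<open>z\<close>. Replacing \<open>z\<close> by
\<open>T z\<close> brings the logarithm to the type of its argument; without this the relation could not
be iterated inside a stratified formula.\<close>

definition is_log :: "'a \<Rightarrow> 'a \<Rightarrow> bool" where
  "is_log w x \<longleftrightarrow> (\<exists>z. w \<approx> T z \<and> x \<approx> Pow z)"

lemma stratified_is_log [THEN stratified_subst2[where P = "\<lambda>x y e. is_log x y"]]:
  "stratified (Suc (Suc t) ## Suc (Suc t) ## \<Gamma>) (\<lambda>e. is_log (e 0) (e (Suc 0)))"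
  unfolding is_log_def by (rule strat stratified_equipotent sterm_T sterm_Pow)+

text \<open>The singletons form a proper subset of the power set, since the empty set is no singleton.\<close>

lemma is_log_smaller:
  assumes "is_log w x" "x \<approx> y"
  obtains v where "w \<approx> v" "v \<sqsubseteq> y" "v \<noteq> y"
proof -
  obtain z where z: "w \<approx> T z" "x \<approx> Pow z"
    using assms(1) by (auto simp: is_log_def)
  have "T z \<sqsubseteq> Pow z" by (auto simp: subset_def)
  moreover have "Pow z \<approx> y"
    using z(2) assms(2) by (blast intro: equipotent_sym equipotent_trans)
  ultimately obtain v where v: "v \<sqsubseteq> y" "T z \<approx> v" "v = y \<Longrightarrow> T z = Pow z"
    using equipotent_subset by blast
  have "\<not> emp \<^bold>\<in> T z" by (metis mem_T mem_emp mem_sing)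
  moreover have "emp \<^bold>\<in> Pow z" by (simp add: subset_def)
  ultimately have "v \<noteq> y" using v(3) by metis
  then show ?thesis using that v z(1) equipotent_trans by blast
qed

text \<open>Logarithms are strictly smaller, so induction on an upper bound \<open>u\<close> for the size applies. A proper
subset of a subset of \<open>ins a u\<close> can be moved into \<open>u\<close> by exchanging \<open>a\<close> for an omitted
element.\<close>

lemma is_log_induct:
  fixes P :: "'a \<Rightarrow> bool"
  assumes P: "stratified (Suc t ## \<Gamma>) (\<lambda>e. P (e 0))"
    and step: "\<And>x. (\<And>w. is_log w x \<Longrightarrow> P w) \<Longrightarrow> P x"
  shows "P x"
proof -
  let ?Q = "\<lambda>u. \<forall>x y. y \<sqsubseteq> u \<and> x \<approx> y \<longrightarrow> P x"
  have "?Q x"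
  proof (rule universe_induct[where P = ?Q])
    have P': "stratified (Suc t ## s ## r ## \<Gamma>) (\<lambda>e. P (e 0))" for s r
      using stratified_weaken_second[OF P] by (rule stratified_weaken_second)
    have P'': "stratified (s ## Suc t ## r ## \<Gamma>) (\<lambda>e. P (e (Suc 0)))" for s r
      by (rule stratified_weaken[OF stratified_weaken_second[OF P]])
    show "stratified (Suc t ## \<Gamma>) (\<lambda>e. ?Q (e 0))"
      by (rule strat stratified_subset stratified_equipotent P'')+
    show "?Q emp"
    proof (intro allI impI)
      fix x y :: 'a assume y: "y \<sqsubseteq> emp \<and> x \<approx> y"
      show "P x"
      proof (rule step)
        fix w assume "is_log w x"
        then obtain v where "v \<sqsubseteq> y" "v \<noteq> y" using is_log_smaller y by blast
        with y show "P w" by (metis eqI subset_def mem_emp)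
      qed
    qed
    fix u a :: 'a
    assume a: "\<not> a \<^bold>\<in> u" and IH: "?Q u"
    show "?Q (ins a u)"
    proof (intro allI impI)
      fix x y :: 'a assume y: "y \<sqsubseteq> ins a u \<and> x \<approx> y"
      show "P x"
      proof (rule step)
        fix w assume "is_log w x"
        then obtain v where v: "w \<approx> v" "v \<sqsubseteq> y" "v \<noteq> y" using is_log_smaller y by blast
        show "P w"
        proof (cases "a \<^bold>\<in> v")
          case False
          then have "v \<sqsubseteq> u" using v y unfolding subset_def by (metis mem_ins)
          with IH v show ?thesis by blast
        next
          case True
          obtain b where b: "b \<^bold>\<in> y" "\<not> b \<^bold>\<in> v" using v unfolding subset_def by (metis eqI)
          obtain v' where v': "\<not> a \<^bold>\<in> v'" "v = ins a v'" using remove_exists[OF True] .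
          have "ins a v' \<approx> ins b v'"
            using equipotent_ins[OF equipotent_refl v'(1), of b] b v' by simp
          then have "w \<approx> ins b v'" using v v' equipotent_trans by blast
          moreover have "ins b v' \<sqsubseteq> u"
            using b v v' y True unfolding subset_def by (metis mem_ins)
          ultimately show ?thesis using IH by blast
        qed
      qed
    qed
  qed
  then show ?thesis using equipotent_refl subset_refl by blast
qed

text \<open>The positions that the first player wins in the game where a move replaces a set by a logarithm of
it and a player without a move loses. Since logarithms are unique up to equipotence, these are the
sets of odd height. The intersection makes this the least set closed under two moves: to win from
\<open>y\<close> is to have a move to some \<open>w\<close> from which every reply leads to a winning position.
The operator that is iterated is monotone, as it would not be for a single move.\<close>

definition odd_height :: 'a where
  "odd_height = nfset (\<lambda>x. \<forall>S. (\<forall>y. (\<exists>w. is_log w y \<and> (\<forall>v. is_log v w \<longrightarrow> v \<^bold>\<in> S)) \<longrightarrow> y \<^bold>\<in> S) \<longrightarrow> x \<^bold>\<in> S)"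

text \<open>A move reverses the parity of the height. A least fixed point only gives the two-move version; that
no position is both won and lost, and that none is a draw, comes from well-foundedness.\<close>

lemma mem_odd_height: "x \<^bold>\<in> odd_height \<longleftrightarrow> (\<exists>w. is_log w x \<and> \<not> w \<^bold>\<in> odd_height)"
proof -
  have odd_height: "x \<^bold>\<in> odd_height \<longleftrightarrow> (\<forall>S. (\<forall>y. (\<exists>w. is_log w y \<and> (\<forall>v. is_log v w \<longrightarrow> v \<^bold>\<in> S)) \<longrightarrow> y \<^bold>\<in> S) \<longrightarrow> x \<^bold>\<in> S)" for x
    unfolding odd_height_def by (rule nfset_iff) (rule strat stratified_is_log)+
  have closed: "x \<^bold>\<in> odd_height" if "is_log w x" "\<forall>v. is_log v w \<longrightarrow> v \<^bold>\<in> odd_height" for w x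
    using that unfolding odd_height by blast
  have unfold: "\<exists>w. is_log w x \<and> (\<forall>v. is_log v w \<longrightarrow> v \<^bold>\<in> odd_height)" if "x \<^bold>\<in> odd_height" for x
  proof -
    define S where "S = nfset (\<lambda>x. \<exists>w. is_log w x \<and> (\<forall>v. is_log v w \<longrightarrow> v \<^bold>\<in> odd_height))"
    have S: "x \<^bold>\<in> S \<longleftrightarrow> (\<exists>w. is_log w x \<and> (\<forall>v. is_log v w \<longrightarrow> v \<^bold>\<in> odd_height))" for x
      unfolding S_def by (rule nfset_iff) (rule strat stratified_is_log)+
    have "\<forall>y. (\<exists>w. is_log w y \<and> (\<forall>v. is_log v w \<longrightarrow> v \<^bold>\<in> S)) \<longrightarrow> y \<^bold>\<in> S"
      using closed unfolding S by blast
    then have "x \<^bold>\<in> S" using that odd_height[of x] by blast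
    then show ?thesis by (simp add: S)
  qed
  have not_both: "\<not> (x \<^bold>\<in> odd_height \<and> (\<forall>w. is_log w x \<longrightarrow> w \<^bold>\<in> odd_height))" for x
  proof (rule is_log_induct[where P = "\<lambda>x. \<not> (x \<^bold>\<in> odd_height \<and> (\<forall>w. is_log w x \<longrightarrow> w \<^bold>\<in> odd_height))"])
    show "stratified (Suc (Suc t) ## \<Gamma>) (\<lambda>e. \<not> (e 0 \<^bold>\<in> odd_height \<and> (\<forall>w. is_log w (e 0) \<longrightarrow> w \<^bold>\<in> odd_height)))" for t \<Gamma>
      by (rule strat stratified_is_log)+
  qed (use unfold in blast)
  have either: "x \<^bold>\<in> odd_height \<or> (\<forall>w. is_log w x \<longrightarrow> w \<^bold>\<in> odd_height)" for x
  proof (rule is_log_induct[where P = "\<lambda>x. x \<^bold>\<in> odd_height \<or> (\<forall>w. is_log w x \<longrightarrow> w \<^bold>\<in> odd_height)"])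
    show "stratified (Suc (Suc t) ## \<Gamma>) (\<lambda>e. e 0 \<^bold>\<in> odd_height \<or> (\<forall>w. is_log w (e 0) \<longrightarrow> w \<^bold>\<in> odd_height))" for t \<Gamma>
      by (rule strat stratified_is_log)+
  qed (use closed in blast)
  show ?thesis
    using unfold not_both either by blast
qed

lemma is_log_cong: "is_log w x \<Longrightarrow> w \<approx> w' \<Longrightarrow> x \<approx> x' \<Longrightarrow> is_log w' x'"
  unfolding is_log_def by (meson equipotent_sym equipotent_trans)

lemma odd_height_cong: "x \<approx> y \<Longrightarrow> x \<^bold>\<in> odd_height \<longleftrightarrow> y \<^bold>\<in> odd_height"
  using mem_odd_height[of x] mem_odd_height[of y] by (meson is_log_cong equipotent_refl equipotent_sym)

lemma is_log_T: "is_log w x \<Longrightarrow> is_log (T w) (T x)"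
  unfolding is_log_def by (meson equipotent_T equipotent_T_Pow equipotent_trans)

lemma Pow_univ: "Pow (univ::'a) = univ"
  by (rule eqI) (simp add: subset_def)

text \<open>A logarithm of \<open>T x\<close> involves a set \<open>z\<close> whose power set has the size of \<open>T x\<close>, and
\<open>z\<close> has to be recognised as some \<open>T z'\<close>. Otherwise \<open>z\<close> would properly contain a copy of
\<open>T univ\<close>, and the power set of that copy already has the size of \<open>T univ\<close>, which
contains \<open>T x\<close>.\<close>

lemma is_log_T_D:
  assumes "is_log w' (T x)"
  obtains w where "w' \<approx> T w" "is_log w x"
proof -
  obtain z where z: "w' \<approx> T z" "T x \<approx> Pow z"
    using assms by (auto simp: is_log_def)
  have "\<exists>z'. z \<approx> T z'"
  proof (rule ccontr)
    assume no: "\<nexists>z'. z \<approx> T z'"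
    then obtain u where u: "u \<sqsubseteq> z" "u \<approx> T (univ::'a)" using compare_T_univ by blast
    have "T (univ::'a) \<approx> Pow u"
      using equipotent_T_Pow[of "univ::'a"] equipotent_Pow[OF u(2)] unfolding Pow_univ
      by (meson equipotent_sym equipotent_trans)
    moreover have "T x \<sqsubseteq> T univ" by (auto simp: subset_def)
    ultimately obtain v where v: "v \<sqsubseteq> Pow u" "T x \<approx> v" using equipotent_subset by blast
    have "Pow u \<sqsubseteq> Pow z" using u(1) by (auto simp: subset_def)
    then have "v = Pow z"
      using v z(2) by (intro dedekind_finite) (auto simp: subset_def intro: equipotent_sym equipotent_trans)
    then have "z \<sqsubseteq> u" using v(1) unfolding subset_def by simp (metis subset_def)
    then have "u = z" using u(1) by (intro subset_antisym)
    then show False using no u(2) by blast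
  qed
  then obtain z' where z': "z \<approx> T z'" ..
  have "T x \<approx> T (Pow z')"
    using z(2) equipotent_Pow[OF z'] equipotent_T_Pow by (meson equipotent_sym equipotent_trans)
  then have "is_log z x"
    using z' equipotent_T_D unfolding is_log_def by blast
  then show ?thesis using that z(1) by blast
qed

text \<open>Singletons preserve the parity of the height because \<open>T\<close> maps logarithms to logarithms and
every logarithm of \<open>T x\<close> arises in this way. The set \<open>odd_height\<close> may occur on both
sides, at two different types, because it is closed.\<close>

lemma odd_height_T: "x \<^bold>\<in> odd_height \<longleftrightarrow> T x \<^bold>\<in> odd_height"
proof (rule is_log_induct[where P = "\<lambda>x. x \<^bold>\<in> odd_height \<longleftrightarrow> T x \<^bold>\<in> odd_height"])
  show "stratified (Suc (Suc t) ## \<Gamma>) (\<lambda>e. e 0 \<^bold>\<in> odd_height \<longleftrightarrow> T (e 0) \<^bold>\<in> odd_height)" for t \<Gamma>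
    by (rule strat sterm_T)+
  fix x assume IH: "\<And>w. is_log w x \<Longrightarrow> w \<^bold>\<in> odd_height \<longleftrightarrow> T w \<^bold>\<in> odd_height"
  show "x \<^bold>\<in> odd_height \<longleftrightarrow> T x \<^bold>\<in> odd_height"
  proof
    assume "x \<^bold>\<in> odd_height"
    then show "T x \<^bold>\<in> odd_height" using mem_odd_height IH is_log_T by metis
  next
    assume "T x \<^bold>\<in> odd_height"
    then obtain w' where "is_log w' (T x)" "\<not> w' \<^bold>\<in> odd_height" using mem_odd_height by metis
    then obtain w where "is_log w x" "\<not> w \<^bold>\<in> odd_height" using is_log_T_D odd_height_cong IH by metis
    then show "x \<^bold>\<in> odd_height" using mem_odd_height by metis
  qed
qed

lemma inconsistent: False
proof -
  have "is_log w univ \<longleftrightarrow> w \<approx> T univ" for w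
  proof
    assume "is_log w univ"
    then obtain z :: 'a where z: "w \<approx> T z" "univ \<approx> Pow z" by (auto simp: is_log_def)
    have "Pow z = univ" using z(2) by (intro dedekind_finite) (simp_all add: subset_def)
    then have "univ \<^bold>\<in> Pow z" by simp
    then have "z = univ" by (intro eqI) (simp add: subset_def)
    with z show "w \<approx> T univ" by simp
  next
    assume "w \<approx> T univ"
    then show "is_log w univ"
      unfolding is_log_def using equipotent_refl Pow_univ by metis
  qed
  then have "univ \<^bold>\<in> odd_height \<longleftrightarrow> \<not> T univ \<^bold>\<in> odd_height"
    using mem_odd_height[of univ] odd_height_cong equipotent_refl by metis
  with odd_height_T[of univ] show False by simp
qed

end

theorem infinity: "n \<^bold>\<in> Nn \<Longrightarrow> \<not> univ \<^bold>\<in> n"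
  using finite_universe.inconsistent finite_universe_def by blast

section \<open>Injectivity of Quine pairs\<close>

text \<open>A set \<open>x\<close> with \<open>n\<close> elements is recovered from the successor of \<open>n\<close> by adding an element
to it, and infinity supplies an element outside \<open>x\<close>.\<close>

lemma succ_inject:
  assumes "m \<^bold>\<in> Nn" "n \<^bold>\<in> Nn" "succ m = succ n"
  shows "m = n"
proof -
  have "x \<^bold>\<in> k" if "x \<^bold>\<in> l" "l \<^bold>\<in> Nn" "k \<^bold>\<in> Nn" "succ l = succ k" for x k l :: 'a
  proof -
    have "x \<noteq> univ" using infinity that by blast
    then obtain a where "\<not> a \<^bold>\<in> x" by (metis eqI mem_univ)
    then show ?thesis
      using that finite_set_remove[of k a x] mem_succ by metis
  qed
  with assms show ?thesis by (metis eqI)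
qed

lemma succ_neq_zero: "succ n \<noteq> zero"
proof
  assume "succ n = zero"
  then have "emp \<^bold>\<in> succ n" by simp
  then show False using mem_succ[of emp n] mem_ins mem_emp by metis
qed

definition bump :: "'a::nf \<Rightarrow> 'a" where
  "bump y = (if y \<^bold>\<in> Nn then succ y else y)"

lemma sterm_bump [THEN sterm_subst]: "sterm (Suc (Suc t) ## \<Gamma>) (Suc (Suc t)) (\<lambda>e. bump (e 0))"
  unfolding bump_def by (rule strat sterm_succ)+

lemma bump_inject: "bump x = bump y \<Longrightarrow> x = y"
  unfolding bump_def by (metis succ_inject succ_in_Nn)

lemma bump_neq_zero: "bump y \<noteq> zero"
  unfolding bump_def by (metis succ_neq_zero zero_in_Nn)

lemma mem_shift: "z \<^bold>\<in> shift x \<longleftrightarrow> (\<exists>y. y \<^bold>\<in> x \<and> z = bump y)"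
  unfolding shift_def bump_def[symmetric] by (rule nfset_iff) (rule strat sterm_bump)+

lemma sterm_shift [THEN sterm_subst]:
  "sterm (Suc (Suc (Suc t)) ## \<Gamma>) (Suc (Suc (Suc t))) (\<lambda>e. shift (e 0))"
  unfolding shift_def bump_def[symmetric] by (rule strat sterm_bump)+

lemma zero_notin_shift: "\<not> zero \<^bold>\<in> shift x"
  using bump_neq_zero by (metis mem_shift)

lemma shift_inject: "shift x = shift y \<longleftrightarrow> x = y"
proof
  assume "shift x = shift y"
  then have *: "(\<exists>u. u \<^bold>\<in> x \<and> bump z = bump u) \<longleftrightarrow> (\<exists>u. u \<^bold>\<in> y \<and> bump z = bump u)" for z
    by (metis mem_shift)
  show "x = y"
    using * by (intro eqI) (blast dest: bump_inject)
qed simp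

lemma mem_pair: "z \<^bold>\<in> \<langle>a, b\<rangle> \<longleftrightarrow>
    (\<exists>x. x \<^bold>\<in> a \<and> z = shift x) \<or> (\<exists>x. x \<^bold>\<in> b \<and> z = union (shift x) (sing zero))"
  unfolding pair_def by (rule nfset_iff) (rule strat sterm_shift sterm_union)+

lemma sterm_pair [THEN sterm_subst2]:
  "sterm (Suc (Suc (Suc (Suc t))) ## Suc (Suc (Suc (Suc t))) ## \<Gamma>) (Suc (Suc (Suc (Suc t))))
    (\<lambda>e. \<langle>e 0, e (Suc 0)\<rangle>)"
  unfolding pair_def by (rule strat sterm_shift sterm_union)+

text \<open>Absence or presence of \<open>zero\<close> tells the codes of members of the first component from those of the second.\<close>

lemma pair_inject [simp]: "\<langle>a, b\<rangle> = \<langle>c, d\<rangle> \<longleftrightarrow> a = c \<and> b = d"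
proof
  have zero: "zero \<^bold>\<in> union (shift x) (sing zero)" for x :: 'a
    by simp
  have shift: "z \<^bold>\<in> shift x \<longleftrightarrow> z \<^bold>\<in> union (shift x) (sing zero) \<and> z \<noteq> zero" for x z :: 'a
    using zero_notin_shift[of x] by auto
  have inj: "union (shift x) (sing zero) = union (shift y) (sing zero) \<longleftrightarrow> x = y" for x y :: 'a
  proof
    assume eq: "union (shift x) (sing zero) = union (shift y) (sing zero)"
    have "shift x = shift y"
      by (rule eqI) (simp only: shift[of _ x] shift[of _ y] eq)
    then show "x = y" by (simp add: shift_inject)
  qed simp
  have neq: "shift x \<noteq> union (shift y) (sing zero)" for x y :: 'a
    using zero[of y] zero_notin_shift[of x] by metis
  have 1: "shift x \<^bold>\<in> \<langle>a, b\<rangle> \<longleftrightarrow> x \<^bold>\<in> a"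
    and 2: "union (shift x) (sing zero) \<^bold>\<in> \<langle>a, b\<rangle> \<longleftrightarrow> x \<^bold>\<in> b" for x a b :: 'a
    by (simp_all add: mem_pair shift_inject inj neq neq[symmetric])
  assume "\<langle>a, b\<rangle> = \<langle>c, d\<rangle>"
  then show "a = c \<and> b = d"
    using 1[of _ a b] 1[of _ c d] 2[of _ a b] 2[of _ c d] by (auto intro: eqI)
qed simp

section \<open>Functions as sets\<close>

lemma stratified_is_function [THEN stratified_subst[where P = "\<lambda>f e. is_function A B f" for A B]]:
  "stratified (Suc (Suc (Suc (Suc (Suc t)))) ## \<Gamma>) (\<lambda>e. is_function A B (e 0))"
  unfolding is_function_def by (rule strat sterm_pair)+

lemma mem_hom: "f \<^bold>\<in> A \<^bold>\<Rightarrow> B \<longleftrightarrow> is_function A B f"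
  unfolding funs_def by (rule nfset_iff) (rule strat stratified_is_function)+

lemma app_eq:
  assumes f: "f \<^bold>\<in> A \<^bold>\<Rightarrow> B"
  shows "\<langle>a, b\<rangle> \<^bold>\<in> f \<longleftrightarrow> a \<^bold>\<in> A \<and> b = f \<^bold>\<cdot> a"
proof -
  have ex1: "\<exists>!b. \<langle>a, b\<rangle> \<^bold>\<in> f" if "a \<^bold>\<in> A"
    using f that by (simp add: mem_hom is_function_def)
  have "a \<^bold>\<in> A" if "\<langle>a, b\<rangle> \<^bold>\<in> f"
    using f that unfolding mem_hom is_function_def by fastforce
  then show ?thesis
    using theI'[OF ex1] ex1 unfolding app_def by blast
qed

lemma app_in:
  assumes f: "f \<^bold>\<in> A \<^bold>\<Rightarrow> B" and a: "a \<^bold>\<in> A"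
  shows "f \<^bold>\<cdot> a \<^bold>\<in> B"
proof -
  have "\<langle>a, f \<^bold>\<cdot> a\<rangle> \<^bold>\<in> f" using a by (simp add: app_eq[OF f])
  then show ?thesis using f unfolding mem_hom is_function_def by fastforce
qed

lemma mem_function:
  assumes f: "f \<^bold>\<in> A \<^bold>\<Rightarrow> B"
  shows "p \<^bold>\<in> f \<longleftrightarrow> (\<exists>a. a \<^bold>\<in> A \<and> p = \<langle>a, f \<^bold>\<cdot> a\<rangle>)"
proof
  assume p: "p \<^bold>\<in> f"
  then obtain a b where "p = \<langle>a, b\<rangle>" using f unfolding mem_hom is_function_def by blast
  with p show "\<exists>a. a \<^bold>\<in> A \<and> p = \<langle>a, f \<^bold>\<cdot> a\<rangle>" by (simp add: app_eq[OF f])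
qed (auto simp: app_eq[OF f])

lemma function_eqI:
  assumes "f \<^bold>\<in> A \<^bold>\<Rightarrow> B" "g \<^bold>\<in> A \<^bold>\<Rightarrow> B'" "\<And>a. a \<^bold>\<in> A \<Longrightarrow> f \<^bold>\<cdot> a = g \<^bold>\<cdot> a"
  shows "f = g"
  by (rule eqI) (use assms mem_function[OF assms(1)] mem_function[OF assms(2)] in auto)

lemma function_of_graph:
  assumes "\<And>p. p \<^bold>\<in> f \<longleftrightarrow> (\<exists>a. a \<^bold>\<in> A \<and> p = \<langle>a, F a\<rangle>)" "\<And>a. a \<^bold>\<in> A \<Longrightarrow> F a \<^bold>\<in> B"
  shows "f \<^bold>\<in> A \<^bold>\<Rightarrow> B" and "a \<^bold>\<in> A \<Longrightarrow> f \<^bold>\<cdot> a = F a"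
proof -
  show f: "f \<^bold>\<in> A \<^bold>\<Rightarrow> B"
    using assms(2) unfolding mem_hom is_function_def by (auto simp: assms(1))
  show "f \<^bold>\<cdot> a = F a" if "a \<^bold>\<in> A"
    using that app_eq[OF f, of a "F a"] by (simp add: assms(1))
qed

lemma mem_ident: "p \<^bold>\<in> ident A \<longleftrightarrow> (\<exists>x. x \<^bold>\<in> A \<and> p = \<langle>x, x\<rangle>)"
  unfolding ident_def by (rule nfset_iff) (rule strat sterm_pair)+

lemma ident_in_hom: "ident A \<^bold>\<in> A \<^bold>\<Rightarrow> A"
  and app_ident: "a \<^bold>\<in> A \<Longrightarrow> ident A \<^bold>\<cdot> a = a"
  by (rule function_of_graph[OF mem_ident]; assumption)+

lemma mem_compose: "p \<^bold>\<in> g \<^bold>\<circ> f \<longleftrightarrow> (\<exists>x y z. \<langle>x, y\<rangle> \<^bold>\<in> f \<and> \<langle>y, z\<rangle> \<^bold>\<in> g \<and> p = \<langle>x, z\<rangle>)"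
  unfolding compose_def by (rule nfset_iff) (rule strat sterm_pair)+

lemma sterm_compose [THEN sterm_subst]:
  "sterm (Suc (Suc (Suc (Suc (Suc t)))) ## \<Gamma>) (Suc (Suc (Suc (Suc (Suc t))))) (\<lambda>e. h \<^bold>\<circ> e 0)"
  unfolding compose_def by (rule strat sterm_pair)+

lemma compose_in_hom: "f \<^bold>\<in> A \<^bold>\<Rightarrow> B \<Longrightarrow> g \<^bold>\<in> B \<^bold>\<Rightarrow> C \<Longrightarrow> g \<^bold>\<circ> f \<^bold>\<in> A \<^bold>\<Rightarrow> C"
  and app_compose: "f \<^bold>\<in> A \<^bold>\<Rightarrow> B \<Longrightarrow> g \<^bold>\<in> B \<^bold>\<Rightarrow> C \<Longrightarrow> a \<^bold>\<in> A \<Longrightarrow> (g \<^bold>\<circ> f) \<^bold>\<cdot> a = g \<^bold>\<cdot> (f \<^bold>\<cdot> a)"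
proof -
  assume f: "f \<^bold>\<in> A \<^bold>\<Rightarrow> B" and g: "g \<^bold>\<in> B \<^bold>\<Rightarrow> C"
  have "p \<^bold>\<in> g \<^bold>\<circ> f \<longleftrightarrow> (\<exists>a. a \<^bold>\<in> A \<and> p = \<langle>a, g \<^bold>\<cdot> (f \<^bold>\<cdot> a)\<rangle>)" for p
    unfolding mem_compose app_eq[OF f] app_eq[OF g] using app_in[OF f] by blast
  note * = function_of_graph[OF this app_in[OF g app_in[OF f]]]
  show "g \<^bold>\<circ> f \<^bold>\<in> A \<^bold>\<Rightarrow> C" by (rule *(1))
  show "a \<^bold>\<in> A \<Longrightarrow> (g \<^bold>\<circ> f) \<^bold>\<cdot> a = g \<^bold>\<cdot> (f \<^bold>\<cdot> a)" by (rule *(2))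
qed

lemma mem_times: "p \<^bold>\<in> A \<^bold>\<times> B \<longleftrightarrow> (\<exists>a b. a \<^bold>\<in> A \<and> b \<^bold>\<in> B \<and> p = \<langle>a, b\<rangle>)"
  unfolding times_def by (rule nfset_iff) (rule strat sterm_pair)+

lemma mem_times_map: "p \<^bold>\<in> times_map f g \<longleftrightarrow>
    (\<exists>a b c d. \<langle>a, b\<rangle> \<^bold>\<in> f \<and> \<langle>c, d\<rangle> \<^bold>\<in> g \<and> p = \<langle>\<langle>a, c\<rangle>, \<langle>b, d\<rangle>\<rangle>)"
  unfolding times_map_def by (rule nfset_iff) (rule strat sterm_pair)+

lemma times_ident_in_hom: "f \<^bold>\<in> X \<^bold>\<Rightarrow> Y \<Longrightarrow> times_map (ident A) f \<^bold>\<in> A \<^bold>\<times> X \<^bold>\<Rightarrow> A \<^bold>\<times> Y"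
  and app_times_ident: "f \<^bold>\<in> X \<^bold>\<Rightarrow> Y \<Longrightarrow> a \<^bold>\<in> A \<Longrightarrow> x \<^bold>\<in> X \<Longrightarrow>
    times_map (ident A) f \<^bold>\<cdot> \<langle>a, x\<rangle> = \<langle>a, f \<^bold>\<cdot> x\<rangle>"
proof -
  assume f: "f \<^bold>\<in> X \<^bold>\<Rightarrow> Y"
  have 1: "p \<^bold>\<in> times_map (ident A) f \<longleftrightarrow> (\<exists>a x. a \<^bold>\<in> A \<and> x \<^bold>\<in> X \<and> p = \<langle>\<langle>a, x\<rangle>, \<langle>a, f \<^bold>\<cdot> x\<rangle>\<rangle>)" for p
    unfolding mem_times_map app_eq[OF f] mem_ident by auto
  have "is_function (A \<^bold>\<times> X) (A \<^bold>\<times> Y) (times_map (ident A) f)"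
    unfolding is_function_def
  proof (intro conjI allI impI)
    fix p assume "p \<^bold>\<in> times_map (ident A) f"
    then show "\<exists>q r. q \<^bold>\<in> A \<^bold>\<times> X \<and> r \<^bold>\<in> A \<^bold>\<times> Y \<and> p = \<langle>q, r\<rangle>"
      unfolding 1 mem_times using app_in[OF f] by blast
  next
    fix q assume "q \<^bold>\<in> A \<^bold>\<times> X"
    then obtain a x where "q = \<langle>a, x\<rangle>" "a \<^bold>\<in> A" "x \<^bold>\<in> X" by (auto simp: mem_times)
    then show "\<exists>!r. \<langle>q, r\<rangle> \<^bold>\<in> times_map (ident A) f"
      by (intro ex1I[of _ "\<langle>a, f \<^bold>\<cdot> x\<rangle>"]) (simp_all add: 1)
  qed
  then show *: "times_map (ident A) f \<^bold>\<in> A \<^bold>\<times> X \<^bold>\<Rightarrow> A \<^bold>\<times> Y"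
    by (simp add: mem_hom)
  show "times_map (ident A) f \<^bold>\<cdot> \<langle>a, x\<rangle> = \<langle>a, f \<^bold>\<cdot> x\<rangle>" if "a \<^bold>\<in> A" "x \<^bold>\<in> X"
    using that app_eq[OF *, of "\<langle>a, x\<rangle>" "\<langle>a, f \<^bold>\<cdot> x\<rangle>"] by (simp add: 1)
qed

lemma mem_T_map: "p \<^bold>\<in> T_map f \<longleftrightarrow> (\<exists>x y. \<langle>x, y\<rangle> \<^bold>\<in> f \<and> p = \<langle>sing x, sing y\<rangle>)"
  unfolding T_map_def by (rule nfset_iff) (rule strat sterm_pair sterm_sing)+

lemma T_map_in_hom: "f \<^bold>\<in> X \<^bold>\<Rightarrow> Y \<Longrightarrow> T_map f \<^bold>\<in> T X \<^bold>\<Rightarrow> T Y"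
  and app_T_map: "f \<^bold>\<in> X \<^bold>\<Rightarrow> Y \<Longrightarrow> x \<^bold>\<in> X \<Longrightarrow> T_map f \<^bold>\<cdot> sing x = sing (f \<^bold>\<cdot> x)"
proof -
  assume f: "f \<^bold>\<in> X \<^bold>\<Rightarrow> Y"
  have 1: "p \<^bold>\<in> T_map f \<longleftrightarrow> (\<exists>x. x \<^bold>\<in> X \<and> p = \<langle>sing x, sing (f \<^bold>\<cdot> x)\<rangle>)" for p
    unfolding mem_T_map app_eq[OF f] by auto
  have "is_function (T X) (T Y) (T_map f)"
    unfolding is_function_def
  proof (intro conjI allI impI)
    fix p assume "p \<^bold>\<in> T_map f"
    then show "\<exists>q r. q \<^bold>\<in> T X \<and> r \<^bold>\<in> T Y \<and> p = \<langle>q, r\<rangle>"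
      unfolding 1 mem_T using app_in[OF f] by blast
  next
    fix q assume "q \<^bold>\<in> T X"
    then obtain x where "q = sing x" "x \<^bold>\<in> X" by auto
    then show "\<exists>!r. \<langle>q, r\<rangle> \<^bold>\<in> T_map f"
      by (intro ex1I[of _ "sing (f \<^bold>\<cdot> x)"]) (simp_all add: 1)
  qed
  then show *: "T_map f \<^bold>\<in> T X \<^bold>\<Rightarrow> T Y"
    by (simp add: mem_hom)
  show "T_map f \<^bold>\<cdot> sing x = sing (f \<^bold>\<cdot> x)" if "x \<^bold>\<in> X"
    using that app_eq[OF *, of "sing x" "sing (f \<^bold>\<cdot> x)"] by (simp add: 1)
qed

lemma prod_functor_simps [simp]:
  "Obj (prod_functor A) X = A \<^bold>\<times> X" "Arr (prod_functor A) X Y f = times_map (ident A) f"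
  by (simp_all add: prod_functor_def)

lemma T_functor_simps [simp]: "Obj T_functor X = T X" "Arr T_functor X Y f = T_map f"
  by (simp_all add: T_functor_def)

lemma exp_functor_Obj [simp]: "Obj (exp_functor A) X = A \<^bold>\<Rightarrow> X"
  by (simp add: exp_functor_def)

lemma prod_functor_is_functor: "is_functor (prod_functor A)"
  unfolding is_functor_def prod_functor_simps
proof (intro conjI allI impI; (elim conjE)?)
  fix X Y f :: 'a
  assume "f \<^bold>\<in> X \<^bold>\<Rightarrow> Y"
  then show "times_map (ident A) f \<^bold>\<in> A \<^bold>\<times> X \<^bold>\<Rightarrow> A \<^bold>\<times> Y" by (rule times_ident_in_hom)
next
  fix X :: 'a
  show "times_map (ident A) (ident X) = ident (A \<^bold>\<times> X)"
    by (rule function_eqI[OF times_ident_in_hom[OF ident_in_hom] ident_in_hom])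
      (auto simp: mem_times app_times_ident[OF ident_in_hom] app_ident)
next
  fix X Y Z f g :: 'a
  assume f: "f \<^bold>\<in> X \<^bold>\<Rightarrow> Y" and g: "g \<^bold>\<in> Y \<^bold>\<Rightarrow> Z"
  show "times_map (ident A) (g \<^bold>\<circ> f) = times_map (ident A) g \<^bold>\<circ> times_map (ident A) f"
    by (rule function_eqI[OF times_ident_in_hom[OF compose_in_hom[OF f g]]
          compose_in_hom[OF times_ident_in_hom[OF f] times_ident_in_hom[OF g]]])
      (auto simp: mem_times app_times_ident[OF compose_in_hom[OF f g]] app_compose[OF f g]
        app_compose[OF times_ident_in_hom[OF f] times_ident_in_hom[OF g]]
        app_times_ident[OF f] app_times_ident[OF g] app_in[OF f])
qed

lemma T_functor_is_functor: "is_functor T_functor"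
  unfolding is_functor_def T_functor_simps
proof (intro conjI allI impI; (elim conjE)?)
  fix X Y f :: 'a
  assume "f \<^bold>\<in> X \<^bold>\<Rightarrow> Y"
  then show "T_map f \<^bold>\<in> T X \<^bold>\<Rightarrow> T Y" by (rule T_map_in_hom)
next
  fix X :: 'a
  show "T_map (ident X) = ident (T X)"
    by (rule function_eqI[OF T_map_in_hom[OF ident_in_hom] ident_in_hom])
      (auto simp: app_T_map[OF ident_in_hom] app_ident)
next
  fix X Y Z f g :: 'a
  assume f: "f \<^bold>\<in> X \<^bold>\<Rightarrow> Y" and g: "g \<^bold>\<in> Y \<^bold>\<Rightarrow> Z"
  show "T_map (g \<^bold>\<circ> f) = T_map g \<^bold>\<circ> T_map f"
    by (rule function_eqI[OF T_map_in_hom[OF compose_in_hom[OF f g]]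
          compose_in_hom[OF T_map_in_hom[OF f] T_map_in_hom[OF g]]])
      (auto simp: app_T_map[OF compose_in_hom[OF f g]] app_compose[OF f g]
        app_compose[OF T_map_in_hom[OF f] T_map_in_hom[OF g]]
        app_T_map[OF f] app_T_map[OF g] app_in[OF f])
qed

lemma
  assumes h: "h \<^bold>\<in> X \<^bold>\<Rightarrow> Y"
  shows exp_arr_in_hom: "Arr (exp_functor A) X Y h \<^bold>\<in> (A \<^bold>\<Rightarrow> X) \<^bold>\<Rightarrow> (A \<^bold>\<Rightarrow> Y)"
    and app_exp_arr: "f \<^bold>\<in> A \<^bold>\<Rightarrow> X \<Longrightarrow> Arr (exp_functor A) X Y h \<^bold>\<cdot> f = h \<^bold>\<circ> f"
proof -
  have "p \<^bold>\<in> Arr (exp_functor A) X Y h \<longleftrightarrow> (\<exists>f. f \<^bold>\<in> A \<^bold>\<Rightarrow> X \<and> p = \<langle>f, h \<^bold>\<circ> f\<rangle>)" for p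
    unfolding exp_functor_def endo.simps by (rule nfset_iff) (rule strat sterm_pair sterm_compose)+
  note * = function_of_graph[OF this compose_in_hom[OF _ h]]
  show "Arr (exp_functor A) X Y h \<^bold>\<in> (A \<^bold>\<Rightarrow> X) \<^bold>\<Rightarrow> (A \<^bold>\<Rightarrow> Y)"
    by (rule *(1))
  show "f \<^bold>\<in> A \<^bold>\<Rightarrow> X \<Longrightarrow> Arr (exp_functor A) X Y h \<^bold>\<cdot> f = h \<^bold>\<circ> f"
    by (rule *(2))
qed

lemma ident_compose:
  assumes f: "f \<^bold>\<in> A \<^bold>\<Rightarrow> B"
  shows "ident B \<^bold>\<circ> f = f"
  by (rule function_eqI[OF compose_in_hom[OF f ident_in_hom] f])
    (simp add: app_compose[OF f ident_in_hom] app_ident app_in[OF f])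

lemma compose_assoc:
  assumes f: "f \<^bold>\<in> A \<^bold>\<Rightarrow> B" and g: "g \<^bold>\<in> B \<^bold>\<Rightarrow> C" and h: "h \<^bold>\<in> C \<^bold>\<Rightarrow> D"
  shows "(h \<^bold>\<circ> g) \<^bold>\<circ> f = h \<^bold>\<circ> (g \<^bold>\<circ> f)"
  by (rule function_eqI[OF compose_in_hom[OF f compose_in_hom[OF g h]]
        compose_in_hom[OF compose_in_hom[OF f g] h]])
    (simp add: app_compose[OF f compose_in_hom[OF g h]] app_compose[OF g h]
      app_compose[OF compose_in_hom[OF f g] h] app_compose[OF f g] app_in[OF f])

lemma exp_functor_is_functor: "is_functor (exp_functor A)"
  unfolding is_functor_def exp_functor_Obj
proof (intro conjI allI impI; (elim conjE)?)
  fix X Y f :: 'a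
  assume "f \<^bold>\<in> X \<^bold>\<Rightarrow> Y"
  then show "Arr (exp_functor A) X Y f \<^bold>\<in> (A \<^bold>\<Rightarrow> X) \<^bold>\<Rightarrow> A \<^bold>\<Rightarrow> Y" by (rule exp_arr_in_hom)
next
  fix X :: 'a
  show "Arr (exp_functor A) X X (ident X) = ident (A \<^bold>\<Rightarrow> X)"
    by (rule function_eqI[OF exp_arr_in_hom[OF ident_in_hom] ident_in_hom])
      (simp add: app_exp_arr[OF ident_in_hom] app_ident ident_compose)
next
  fix X Y Z f g :: 'a
  assume f: "f \<^bold>\<in> X \<^bold>\<Rightarrow> Y" and g: "g \<^bold>\<in> Y \<^bold>\<Rightarrow> Z"
  show "Arr (exp_functor A) X Z (g \<^bold>\<circ> f) = Arr (exp_functor A) Y Z g \<^bold>\<circ> Arr (exp_functor A) X Y f"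
    by (rule function_eqI[OF exp_arr_in_hom[OF compose_in_hom[OF f g]]
          compose_in_hom[OF exp_arr_in_hom[OF f] exp_arr_in_hom[OF g]]])
      (simp add: app_exp_arr[OF compose_in_hom[OF f g]] app_exp_arr[OF f] app_exp_arr[OF g]
        app_compose[OF exp_arr_in_hom[OF f] exp_arr_in_hom[OF g]] compose_in_hom[OF _ f]
        compose_assoc[OF _ f g])
qed

text \<open>Application is a definite description and not a stratified term where its uniqueness fails, so the
defining condition is first rewritten with membership in the graph.\<close>

lemma mem_ev: "p \<^bold>\<in> ev' A B \<longleftrightarrow>
    (\<exists>x f. x \<^bold>\<in> A \<and> f \<^bold>\<in> (A \<^bold>\<Rightarrow> B) \<and> p = \<langle>\<langle>sing x, f\<rangle>, sing (f \<^bold>\<cdot> x)\<rangle>)"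
proof -
  have eq: "(\<lambda>p. \<exists>x f. x \<^bold>\<in> A \<and> f \<^bold>\<in> (A \<^bold>\<Rightarrow> B) \<and> p = \<langle>\<langle>sing x, f\<rangle>, sing (f \<^bold>\<cdot> x)\<rangle>) =
    (\<lambda>p. \<exists>x f y. f \<^bold>\<in> (A \<^bold>\<Rightarrow> B) \<and> \<langle>x, y\<rangle> \<^bold>\<in> f \<and> p = \<langle>\<langle>sing x, f\<rangle>, sing y\<rangle>)"
  proof -
    have "f \<^bold>\<in> (A \<^bold>\<Rightarrow> B) \<and> \<langle>x, y\<rangle> \<^bold>\<in> f \<and> q \<longleftrightarrow>
        f \<^bold>\<in> (A \<^bold>\<Rightarrow> B) \<and> x \<^bold>\<in> A \<and> y = f \<^bold>\<cdot> x \<and> q" for f x y q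
      using app_eq[of f A B x y] by blast
    then show ?thesis by auto
  qed
  have "p \<^bold>\<in> ev' A B \<longleftrightarrow> (\<exists>x f y. f \<^bold>\<in> (A \<^bold>\<Rightarrow> B) \<and> \<langle>x, y\<rangle> \<^bold>\<in> f \<and> p = \<langle>\<langle>sing x, f\<rangle>, sing y\<rangle>)"
    unfolding ev'_def eq by (rule nfset_iff) (rule strat sterm_pair sterm_sing)+
  then show ?thesis by (simp only: fun_cong[OF eq])
qed

lemma ev_in_hom: "ev' A B \<^bold>\<in> T A \<^bold>\<times> (A \<^bold>\<Rightarrow> B) \<^bold>\<Rightarrow> T B"
  unfolding mem_hom is_function_def
proof (intro conjI allI impI)
  fix p assume "p \<^bold>\<in> ev' A B"
  then show "\<exists>q r. q \<^bold>\<in> T A \<^bold>\<times> (A \<^bold>\<Rightarrow> B) \<and> r \<^bold>\<in> T B \<and> p = \<langle>q, r\<rangle>"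
    unfolding mem_ev mem_times mem_T using app_in by blast
next
  fix q assume "q \<^bold>\<in> T A \<^bold>\<times> (A \<^bold>\<Rightarrow> B)"
  then obtain x f where "q = \<langle>sing x, f\<rangle>" "x \<^bold>\<in> A" "f \<^bold>\<in> A \<^bold>\<Rightarrow> B" by (auto simp: mem_times)
  then show "\<exists>!r. \<langle>q, r\<rangle> \<^bold>\<in> ev' A B"
    by (intro ex1I[of _ "sing (f \<^bold>\<cdot> x)"]) (simp_all add: mem_ev)
qed

lemma app_ev: "x \<^bold>\<in> A \<Longrightarrow> f \<^bold>\<in> A \<^bold>\<Rightarrow> B \<Longrightarrow> ev' A B \<^bold>\<cdot> \<langle>sing x, f\<rangle> = sing (f \<^bold>\<cdot> x)"
  using app_eq[OF ev_in_hom, of "\<langle>sing x, f\<rangle>" "sing (f \<^bold>\<cdot> x)" A B] by (auto simp: mem_ev)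

text \<open>This is where \<open>T\<close> is indispensable. Pairs are type-level, so in a graph \<open>g\<close> of pairs
\<open>\<langle>\<langle>{a}, x\<rangle>, {y}\<rangle>\<close> the argument \<open>x\<close> lies one type above \<open>a\<close> and
\<open>y\<close>, which is exactly the type of a set of pairs \<open>\<langle>a, y\<rangle>\<close>. Hence
\<open>x \<mapsto> slice g x\<close> is given by a stratified condition.\<close>

definition slice :: "'a::nf \<Rightarrow> 'a \<Rightarrow> 'a" where
  "slice g x = nfset (\<lambda>p. \<exists>a y. p = \<langle>a, y\<rangle> \<and> \<langle>\<langle>sing a, x\<rangle>, sing y\<rangle> \<^bold>\<in> g)"

lemma mem_slice: "p \<^bold>\<in> slice g x \<longleftrightarrow> (\<exists>a y. p = \<langle>a, y\<rangle> \<and> \<langle>\<langle>sing a, x\<rangle>, sing y\<rangle> \<^bold>\<in> g)"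
  unfolding slice_def by (rule nfset_iff) (rule strat sterm_pair sterm_sing)+

lemma sterm_slice [THEN sterm_subst2]:
  "sterm (Suc (Suc (Suc (Suc (Suc (Suc t))))) ## Suc (Suc (Suc (Suc (Suc t)))) ## \<Gamma>)
    (Suc (Suc (Suc (Suc (Suc t))))) (\<lambda>e. slice (e 0) (e (Suc 0)))"
  unfolding slice_def by (rule strat sterm_pair sterm_sing)+

lemma
  assumes g: "g \<^bold>\<in> T A \<^bold>\<times> X \<^bold>\<Rightarrow> T B" and x: "x \<^bold>\<in> X"
  shows slice_in_hom: "slice g x \<^bold>\<in> A \<^bold>\<Rightarrow> B"
    and app_slice: "a \<^bold>\<in> A \<Longrightarrow> sing (slice g x \<^bold>\<cdot> a) = g \<^bold>\<cdot> \<langle>sing a, x\<rangle>"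
proof -
  have mem: "\<langle>a, y\<rangle> \<^bold>\<in> slice g x \<longleftrightarrow> a \<^bold>\<in> A \<and> sing y = g \<^bold>\<cdot> \<langle>sing a, x\<rangle>" for a y
    using x by (auto simp: mem_slice app_eq[OF g] mem_times)
  have val: "\<exists>y. y \<^bold>\<in> B \<and> g \<^bold>\<cdot> \<langle>sing a, x\<rangle> = sing y" if "a \<^bold>\<in> A" for a
    using app_in[OF g, of "\<langle>sing a, x\<rangle>"] that x by (auto simp: mem_times)
  show *: "slice g x \<^bold>\<in> A \<^bold>\<Rightarrow> B"
    unfolding mem_hom is_function_def
  proof (intro conjI allI impI)
    fix p assume "p \<^bold>\<in> slice g x"
    then obtain a y where p: "p = \<langle>a, y\<rangle>" "a \<^bold>\<in> A" "sing y = g \<^bold>\<cdot> \<langle>sing a, x\<rangle>"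
      using mem mem_slice by metis
    then show "\<exists>a b. a \<^bold>\<in> A \<and> b \<^bold>\<in> B \<and> p = \<langle>a, b\<rangle>"
      using val[OF p(2)] by auto
  next
    fix a assume a: "a \<^bold>\<in> A"
    then show "\<exists>!b. \<langle>a, b\<rangle> \<^bold>\<in> slice g x"
      using val[OF a] by (auto simp: mem)
  qed
  show "sing (slice g x \<^bold>\<cdot> a) = g \<^bold>\<cdot> \<langle>sing a, x\<rangle>" if "a \<^bold>\<in> A"
    using that app_eq[OF *, of a] mem by blast
qed

definition curried :: "'a::nf \<Rightarrow> 'a \<Rightarrow> 'a" where
  "curried X g = nfset (\<lambda>p. \<exists>x. x \<^bold>\<in> X \<and> p = \<langle>x, slice g x\<rangle>)"

lemma sterm_curried [THEN sterm_subst]: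
  "sterm (Suc (Suc (Suc (Suc (Suc (Suc t))))) ## \<Gamma>) (Suc (Suc (Suc (Suc (Suc (Suc t))))))
    (\<lambda>e. curried X (e 0))"
  unfolding curried_def by (rule strat sterm_pair sterm_slice)+

lemma mem_curried: "p \<^bold>\<in> curried X g \<longleftrightarrow> (\<exists>x. x \<^bold>\<in> X \<and> p = \<langle>x, slice g x\<rangle>)"
  unfolding curried_def by (rule nfset_iff) (rule strat sterm_pair sterm_slice)+

lemma
  assumes g: "g \<^bold>\<in> T A \<^bold>\<times> X \<^bold>\<Rightarrow> T B"
  shows curried_in_hom: "curried X g \<^bold>\<in> X \<^bold>\<Rightarrow> (A \<^bold>\<Rightarrow> B)"
    and app_curried: "x \<^bold>\<in> X \<Longrightarrow> a \<^bold>\<in> A \<Longrightarrow> sing (curried X g \<^bold>\<cdot> x \<^bold>\<cdot> a) = g \<^bold>\<cdot> \<langle>sing a, x\<rangle>"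
proof -
  note * = function_of_graph[OF mem_curried slice_in_hom[OF g]]
  show "curried X g \<^bold>\<in> X \<^bold>\<Rightarrow> (A \<^bold>\<Rightarrow> B)" by (rule *(1))
  show "sing (curried X g \<^bold>\<cdot> x \<^bold>\<cdot> a) = g \<^bold>\<cdot> \<langle>sing a, x\<rangle>" if "x \<^bold>\<in> X" "a \<^bold>\<in> A"
    using that *(2) app_slice[OF g] by simp
qed

text \<open>Transposes are characterised by their values alone, which reduces the naturality squares and the
co-unit to evaluation at a pair \<open>\<langle>{a}, x\<rangle>\<close>.\<close>

lemma curried_eqI:
  assumes g: "g \<^bold>\<in> T A \<^bold>\<times> X \<^bold>\<Rightarrow> T B" and u: "u \<^bold>\<in> X \<^bold>\<Rightarrow> (A \<^bold>\<Rightarrow> B)"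
    and eq: "\<And>a x. a \<^bold>\<in> A \<Longrightarrow> x \<^bold>\<in> X \<Longrightarrow> g \<^bold>\<cdot> \<langle>sing a, x\<rangle> = sing (u \<^bold>\<cdot> x \<^bold>\<cdot> a)"
  shows "curried X g = u"
proof (rule function_eqI[OF curried_in_hom[OF g] u])
  fix x assume x: "x \<^bold>\<in> X"
  show "curried X g \<^bold>\<cdot> x = u \<^bold>\<cdot> x"
    using app_curried[OF g x] eq x
    by (intro function_eqI[OF app_in[OF curried_in_hom[OF g] x] app_in[OF u x]]) (metis sing_inject)
qed

lemma
  assumes u: "u \<^bold>\<in> X \<^bold>\<Rightarrow> (A \<^bold>\<Rightarrow> B)"
  shows uncurried_in_hom: "ev' A B \<^bold>\<circ> times_map (ident (T A)) u \<^bold>\<in> T A \<^bold>\<times> X \<^bold>\<Rightarrow> T B"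
    and app_uncurried: "a \<^bold>\<in> A \<Longrightarrow> x \<^bold>\<in> X \<Longrightarrow>
      (ev' A B \<^bold>\<circ> times_map (ident (T A)) u) \<^bold>\<cdot> \<langle>sing a, x\<rangle> = sing (u \<^bold>\<cdot> x \<^bold>\<cdot> a)"
    and curried_uncurried: "curried X (ev' A B \<^bold>\<circ> times_map (ident (T A)) u) = u"
proof -
  show 1: "ev' A B \<^bold>\<circ> times_map (ident (T A)) u \<^bold>\<in> T A \<^bold>\<times> X \<^bold>\<Rightarrow> T B"
    by (rule compose_in_hom[OF times_ident_in_hom[OF u] ev_in_hom])
  show 2: "(ev' A B \<^bold>\<circ> times_map (ident (T A)) u) \<^bold>\<cdot> \<langle>sing a, x\<rangle> = sing (u \<^bold>\<cdot> x \<^bold>\<cdot> a)"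
    if "a \<^bold>\<in> A" "x \<^bold>\<in> X" for a x
    using that app_in[OF u]
    by (simp add: app_compose[OF times_ident_in_hom[OF u] ev_in_hom] app_times_ident[OF u] app_ev mem_times)
  show "curried X (ev' A B \<^bold>\<circ> times_map (ident (T A)) u) = u"
    by (rule curried_eqI[OF 1 u 2])
qed

lemma uncurried_curried:
  assumes g: "g \<^bold>\<in> T A \<^bold>\<times> X \<^bold>\<Rightarrow> T B"
  shows "ev' A B \<^bold>\<circ> times_map (ident (T A)) (curried X g) = g"
  by (rule function_eqI[OF uncurried_in_hom[OF curried_in_hom[OF g]] g])
    (auto simp: mem_times app_uncurried[OF curried_in_hom[OF g]] app_curried[OF g])

text \<open>The component of the adjunction is itself a set of the model, because a transpose has the type of
the function that it comes from.\<close>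

definition transposition :: "'a::nf \<Rightarrow> 'a \<Rightarrow> 'a \<Rightarrow> 'a" where
  "transposition A X Y = nfset (\<lambda>p. \<exists>g. g \<^bold>\<in> (T A \<^bold>\<times> X \<^bold>\<Rightarrow> T Y) \<and> p = \<langle>g, curried X g\<rangle>)"

lemma mem_transposition:
  "p \<^bold>\<in> transposition A X Y \<longleftrightarrow> (\<exists>g. g \<^bold>\<in> (T A \<^bold>\<times> X \<^bold>\<Rightarrow> T Y) \<and> p = \<langle>g, curried X g\<rangle>)"
  unfolding transposition_def by (rule nfset_iff) (rule strat sterm_pair sterm_curried)+

lemma transposition_in_hom:
  "transposition A X Y \<^bold>\<in> (T A \<^bold>\<times> X \<^bold>\<Rightarrow> T Y) \<^bold>\<Rightarrow> (X \<^bold>\<Rightarrow> (A \<^bold>\<Rightarrow> Y))"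
  by (rule function_of_graph(1)[OF mem_transposition]) (rule curried_in_hom)

lemma app_transposition:
  "g \<^bold>\<in> T A \<^bold>\<times> X \<^bold>\<Rightarrow> T Y \<Longrightarrow> transposition A X Y \<^bold>\<cdot> g = curried X g"
  by (rule function_of_graph(2)[OF mem_transposition]) (rule curried_in_hom)

lemma couniversal_arrow_ev: "couniversal_arrow (prod_functor (T A)) (A \<^bold>\<Rightarrow> B) (ev' A B) (T B)"
proof -
  have "\<exists>!u. u \<^bold>\<in> C \<^bold>\<Rightarrow> A \<^bold>\<Rightarrow> B \<and> ev' A B \<^bold>\<circ> times_map (ident (T A)) u = g"
    if "g \<^bold>\<in> T A \<^bold>\<times> C \<^bold>\<Rightarrow> T B" for C g
    by (rule ex1I[of _ "curried C g"])
      (auto simp: curried_in_hom[OF that] uncurried_curried[OF that] curried_uncurried)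
  then show ?thesis
    by (simp add: couniversal_arrow_def prod_functor_is_functor ev_in_hom)
qed

lemma rel_adjunction_transposition:
  "rel_adjunction (prod_functor (T A)) T_functor (exp_functor A) (transposition A)"
proof -
  have bij: "bijection (T A \<^bold>\<times> X \<^bold>\<Rightarrow> T Y) (X \<^bold>\<Rightarrow> A \<^bold>\<Rightarrow> Y) (transposition A X Y)" for X Y
    unfolding bijection_def
  proof (intro conjI allI impI)
    show "transposition A X Y \<^bold>\<in> (T A \<^bold>\<times> X \<^bold>\<Rightarrow> T Y) \<^bold>\<Rightarrow> (X \<^bold>\<Rightarrow> A \<^bold>\<Rightarrow> Y)"
      by (rule transposition_in_hom)
    fix u assume "u \<^bold>\<in> X \<^bold>\<Rightarrow> A \<^bold>\<Rightarrow> Y"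
    then show "\<exists>!g. g \<^bold>\<in> (T A \<^bold>\<times> X \<^bold>\<Rightarrow> T Y) \<and> transposition A X Y \<^bold>\<cdot> g = u"
      by (intro ex1I[of _ "ev' A Y \<^bold>\<circ> times_map (ident (T A)) u"])
        (auto simp: app_transposition uncurried_in_hom curried_uncurried uncurried_curried)
  qed
  have nat_left: "transposition A X' Y \<^bold>\<cdot> (g \<^bold>\<circ> times_map (ident (T A)) k) = (transposition A X Y \<^bold>\<cdot> g) \<^bold>\<circ> k"
    if k: "k \<^bold>\<in> X' \<^bold>\<Rightarrow> X" and g: "g \<^bold>\<in> T A \<^bold>\<times> X \<^bold>\<Rightarrow> T Y" for X X' Y k g
  proof -
    note gk = compose_in_hom[OF times_ident_in_hom[OF k] g]
    have "curried X' (g \<^bold>\<circ> times_map (ident (T A)) k) = curried X g \<^bold>\<circ> k"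
      by (rule curried_eqI[OF gk compose_in_hom[OF k curried_in_hom[OF g]]])
        (simp add: app_compose[OF times_ident_in_hom[OF k] g] app_compose[OF k curried_in_hom[OF g]]
          app_times_ident[OF k] app_curried[OF g] app_in[OF k] mem_times)
    then show ?thesis
      by (simp add: app_transposition[OF gk] app_transposition[OF g])
  qed
  have nat_right: "transposition A X Y' \<^bold>\<cdot> (T_map h \<^bold>\<circ> g) =
      Arr (exp_functor A) Y Y' h \<^bold>\<circ> (transposition A X Y \<^bold>\<cdot> g)"
    if h: "h \<^bold>\<in> Y \<^bold>\<Rightarrow> Y'" and g: "g \<^bold>\<in> T A \<^bold>\<times> X \<^bold>\<Rightarrow> T Y" for X Y Y' h g
  proof -
    note hg = compose_in_hom[OF g T_map_in_hom[OF h]]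
    note c = curried_in_hom[OF g]
    have "curried X (T_map h \<^bold>\<circ> g) = Arr (exp_functor A) Y Y' h \<^bold>\<circ> curried X g"
    proof (rule curried_eqI[OF hg compose_in_hom[OF c exp_arr_in_hom[OF h]]])
      fix a x assume a: "a \<^bold>\<in> A" and x: "x \<^bold>\<in> X"
      have "(T_map h \<^bold>\<circ> g) \<^bold>\<cdot> \<langle>sing a, x\<rangle> = T_map h \<^bold>\<cdot> sing (curried X g \<^bold>\<cdot> x \<^bold>\<cdot> a)"
        using a x by (simp add: app_compose[OF g T_map_in_hom[OF h]] app_curried[OF g] mem_times)
      also have "\<dots> = sing (h \<^bold>\<cdot> (curried X g \<^bold>\<cdot> x \<^bold>\<cdot> a))"
        by (rule app_T_map[OF h app_in[OF app_in[OF c x] a]])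
      also have "h \<^bold>\<cdot> (curried X g \<^bold>\<cdot> x \<^bold>\<cdot> a) = (Arr (exp_functor A) Y Y' h \<^bold>\<circ> curried X g) \<^bold>\<cdot> x \<^bold>\<cdot> a"
        using a x by (simp add: app_compose[OF c exp_arr_in_hom[OF h]] app_exp_arr[OF h app_in[OF c x]]
            app_compose[OF app_in[OF c x] h])
      finally show "(T_map h \<^bold>\<circ> g) \<^bold>\<cdot> \<langle>sing a, x\<rangle> =
        sing ((Arr (exp_functor A) Y Y' h \<^bold>\<circ> curried X g) \<^bold>\<cdot> x \<^bold>\<cdot> a)" .
    qed
    then show ?thesis
      by (simp add: app_transposition[OF hg] app_transposition[OF g])
  qed
  show ?thesis
    using bij nat_left nat_right
    by (simp add: rel_adjunction_def prod_functor_is_functor T_functor_is_functor exp_functor_is_functor)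
qed

lemma has_counit_ev:
  "has_counit (prod_functor (T A)) T_functor (exp_functor A) (transposition A) (ev' A)"
proof -
  have "curried (A \<^bold>\<Rightarrow> Y) (ev' A Y) = ident (A \<^bold>\<Rightarrow> Y)" for Y
    by (rule curried_eqI[OF ev_in_hom ident_in_hom]) (simp add: app_ev app_ident)
  then show ?thesis
    by (simp add: has_counit_def ev_in_hom app_transposition[OF ev_in_hom])
qed

theorem proposition12:
  fixes A :: "'a::nf"
  shows "(\<forall>B. (\<forall>x f. x \<^bold>\<in> A \<and> f \<^bold>\<in> (A \<^bold>\<Rightarrow> B) \<longrightarrow> ev' A B \<^bold>\<cdot> \<langle>sing x, f\<rangle> = sing (f \<^bold>\<cdot> x)) \<and>
              couniversal_arrow (prod_functor (T A)) (A \<^bold>\<Rightarrow> B) (ev' A B) (T B)) \<and>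
         (\<exists>\<Phi>. rel_adjunction (prod_functor (T A)) T_functor (exp_functor A) \<Phi> \<and>
              has_counit (prod_functor (T A)) T_functor (exp_functor A) \<Phi> (ev' A))"
  using app_ev couniversal_arrow_ev rel_adjunction_transposition has_counit_ev by blast

end
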